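(* The following is a complete list of the two-dimensional real Lie subalgebras of $\mathfrak{sl}_3(\mathbb{R})$ up to conjugation in $\mathrm{SL}_3(\mathbb{R})$: (1) $\mathfrak{u}_{2,1}=\langle X_\alpha+X_\beta,\,X_{\alpha+\beta}\rangle$; (2) $\mathfrak{u}_{2,2}=\langle X_\alpha,\,H_\alpha+2H_\beta\rangle$; (3) $\mathfrak{u}_{2,3}=\langle X_\alpha,\,X_{\alpha+\beta}\rangle$; (4) $\mathfrak{u}_{2,4}=\langle X_\alpha,\,Y_\beta\rangle$; (5) $\mathfrak{u}_{2,5}=\langle H_\alpha,\,H_\beta\rangle$; (6) $\mathfrak{u}_{2,6}=\langle -X_{\alpha+\beta}+Y_{\alpha+\beta},\,H_\alpha-H_\beta\rangle$; (7) $\mathfrak{u}_{2,7}=\langle X_\alpha+X_\beta,\,H_\alpha+H_\beta\rangle$; (8) $\mathfrak{u}_{2,8}=\langle X_\alpha,\,-H_\alpha+H_\beta+3X_{\alpha+\beta}\rangle$; (9) $\mathfrak{u}_{2,9}=\langle X_\alpha,\,-2H_\alpha-H_\beta+3Y_\beta\rangle$; (10) $\mathfrak{u}_{2,10}^a=\langle X_\alpha,\,aH_\alpha+(2a+1)H_\beta\rangle$, $a\in\mathbb{R}$, where $\mathfrak{u}_{2,10}^a\sim\mathfrak{u}_{2,10}^b$ if and only if $a=b$. That is, every two-dimensional real subalgebra of $\mathfrak{sl}_3(\mathbb{R})$ is conjugate under $\mathrm{SL}_3(\mathbb{R})$ to a subalgebra in this list, and distinct entries of the list (including distinct parameter values in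 (10)) are non-conjugate under $\mathrm{SL}_3(\mathbb{R})$.
   Context: $\mathfrak{sl}_3(\mathbb{R})$ is the Lie algebra of traceless real $3\times3$ matrices and $\mathrm{SL}_3(\mathbb{R})$ acts on its subalgebras by $g\cdot\mathfrak{u}=g\mathfrak{u}g^{-1}$; $\mathfrak{u}\sim\mathfrak{v}$ means that $\mathfrak{u}$ and $\mathfrak{v}$ lie in the same orbit of this action. With $E_{ij}$ the matrix units, the basis of $\mathfrak{sl}_3(\mathbb{R})$ used is $H_\alpha=E_{11}-E_{22}$, $H_\beta=E_{22}-E_{33}$, $X_\alpha=E_{12}$, $X_\beta=E_{23}$, $X_{\alpha+\beta}=-E_{13}$, $Y_\alpha=E_{21}$, $Y_\beta=E_{32}$, $Y_{\alpha+\beta}=-E_{31}$. $\langle\cdots\rangle$ denotes the real linear span. *)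

theory Defs
  imports "HOL-Analysis.Analysis"
begin

type_synonym mat3 = "real ^ 3 ^ 3"

definition sl3 :: "mat3 set"
  where "sl3 = {x. trace x = 0}"

definition SL3 :: "mat3 set"
  where "SL3 = {g. det g = 1}"

definition bracket :: "mat3 \<Rightarrow> mat3 \<Rightarrow> mat3"
  where "bracket x y = x ** y - y ** x"

definition lie_subalgebra_sl3 :: "mat3 set \<Rightarrow> bool"
  where "lie_subalgebra_sl3 \<uu> \<longleftrightarrow>
    \<uu> \<subseteq> sl3 \<and> subspace \<uu> \<and> (\<forall>x\<in>\<uu>. \<forall>y\<in>\<uu>. bracket x y \<in> \<uu>)"

definition conj_action :: "mat3 \<Rightarrow> mat3 set \<Rightarrow> mat3 set"
  where "conj_action g \<uu> = (\<lambda>x. g ** x ** matrix_inv g) ` \<uu>"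

definition SL3_conjugate :: "mat3 set \<Rightarrow> mat3 set \<Rightarrow> bool"  (infix \<open>\<sim>\<^sub>S\<^sub>L\<close> 50)
  where "\<uu> \<sim>\<^sub>S\<^sub>L \<vv> \<longleftrightarrow> (\<exists>g\<in>SL3. \<vv> = conj_action g \<uu>)"

text \<open>The index type \<^typ>\<open>3\<close> has exactly the elements 1, 2 and 3 (with 3 = 0); the first
  argument of \<open>E\<close> is the row, the second the column.\<close>

definition E :: "3 \<Rightarrow> 3 \<Rightarrow> mat3"
  where "E i j = (\<chi> r c. if r = i \<and> c = j then 1 else 0)"

definition H\<alpha> :: mat3 where "H\<alpha> = E 1 1 - E 2 2"
definition H\<beta> :: mat3 where "H\<beta> = E 2 2 - E 3 3"
definition X\<alpha> :: mat3 where "X\<alpha> = E 1 2"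
definition X\<beta> :: mat3 where "X\<beta> = E 2 3"
definition X\<alpha>\<beta> :: mat3 where "X\<alpha>\<beta> = - E 1 3"  \<comment> \<open>root \<open>\<alpha> + \<beta>\<close>\<close>
definition Y\<alpha> :: mat3 where "Y\<alpha> = E 2 1"
definition Y\<beta> :: mat3 where "Y\<beta> = E 3 2"
definition Y\<alpha>\<beta> :: mat3 where "Y\<alpha>\<beta> = - E 3 1"  \<comment> \<open>root \<open>- (\<alpha> + \<beta>)\<close>\<close>

text \<open>One label per entry of the classification list, so that two entries of the list are the
  same entry iff their labels are equal; the last entry is a family with a real parameter.\<close>

datatype entry =
  U1 | U2 | U3 | U4 | U5 | U6 | U7 | U8 | U9 | U10 real

fun \<uu>2 :: "entry \<Rightarrow> mat3 set" where
  "\<uu>2 U1 = span {X\<alpha> + X\<beta>, X\<alpha>\<beta>}"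
| "\<uu>2 U2 = span {X\<alpha>, H\<alpha> + 2 *\<^sub>R H\<beta>}"
| "\<uu>2 U3 = span {X\<alpha>, X\<alpha>\<beta>}"
| "\<uu>2 U4 = span {X\<alpha>, Y\<beta>}"
| "\<uu>2 U5 = span {H\<alpha>, H\<beta>}"
| "\<uu>2 U6 = span {- X\<alpha>\<beta> + Y\<alpha>\<beta>, H\<alpha> - H\<beta>}"
| "\<uu>2 U7 = span {X\<alpha> + X\<beta>, H\<alpha> + H\<beta>}"
| "\<uu>2 U8 = span {X\<alpha>, - H\<alpha> + H\<beta> + 3 *\<^sub>R X\<alpha>\<beta>}"
| "\<uu>2 U9 = span {X\<alpha>, - 2 *\<^sub>R H\<alpha> - H\<beta> + 3 *\<^sub>R Y\<beta>}"
| "\<uu>2 (U10 a) = span {X\<alpha>, a *\<^sub>R H\<alpha> + (2 * a + 1) *\<^sub>R H\<beta>}"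

end

theory Submission
  imports Defs
begin

text \<open>
  In odd dimension \<open>SL\<^sub>3\<close>-conjugacy is the same as \<open>GL\<^sub>3\<close>-conjugacy, since a determinant can be
  scaled away by a real cube root. So one may change to any basis.

  If \<open>\<uu>\<close> is not abelian, it is spanned by \<open>z\<close> and \<open>h\<close> with \<open>[h, z] = - z\<close>. Then \<open>z\<close> is nilpotent,
  hence conjugate to \<open>E\<^sub>1\<^sub>2 + E\<^sub>2\<^sub>3\<close> or \<open>E\<^sub>1\<^sub>2\<close>, and \<open>h\<close> is determined up to the centralizer of \<open>z\<close>.

  If \<open>\<uu>\<close> is abelian and contains an element \<open>x\<close> with a cyclic vector, then \<open>\<uu>\<close> is the traceless part of
  the commutant of \<open>x\<close>, so the factorisation of the characteristic polynomial of \<open>x\<close> decides. A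
  traceless \<open>x\<close> without a cyclic vector satisfies \<open>(x - a) (x + 2a) = 0\<close> for some \<open>a\<close>. If this holds
  on all of \<open>\<uu>\<close>, comparing \<open>x\<close>, \<open>y\<close>, \<open>x + y\<close> and \<open>x - y\<close> shows that all products in \<open>\<uu>\<close> vanish.

  The list entries are separated by conjugation invariants. For the family it is the eigenvalue \<open>a\<close> of \<open>h\<close>
  on the image of \<open>z\<close>; the entries 8 and 9 share it with the parameters \<open>- 1/3\<close> and \<open>- 2/3\<close>, where
  only diagonalizability of \<open>h\<close> tells them apart.
\<close>

section \<open>Matrices by entries and change of basis\<close>

definition mat3_of :: "real \<Rightarrow> real \<Rightarrow> real \<Rightarrow> real \<Rightarrow> real \<Rightarrow> real \<Rightarrow> real \<Rightarrow> real \<Rightarrow> real \<Rightarrow> mat3" where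
  "mat3_of a b c d e f g h i = vector [vector [a, b, c], vector [d, e, f], vector [g, h, i]]"

lemma mat3_of_nth [simp]:
  "mat3_of a b c d e f g h i $ 1 = vector [a, b, c]"
  "mat3_of a b c d e f g h i $ 2 = vector [d, e, f]"
  "mat3_of a b c d e f g h i $ 3 = vector [g, h, i]"
  by (simp_all add: mat3_of_def)

lemma mat3_eq_iff: "A = B \<longleftrightarrow> (\<forall>i j. A $ i $ j = (B :: mat3) $ i $ j)"
  by (simp add: vec_eq_iff)

lemma mat3_cases [cases type]:
  obtains a b c d e f g h i where "A = mat3_of a b c d e f g h i"
proof -
  have "A = mat3_of (A$1$1) (A$1$2) (A$1$3) (A$2$1) (A$2$2) (A$2$3) (A$3$1) (A$3$2) (A$3$3)"
    by (simp add: mat3_eq_iff forall_3)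
  then show ?thesis using that by blast
qed

lemma mat3_of_eq_iff [simp]:
  "mat3_of a b c d e f g h i = mat3_of a' b' c' d' e' f' g' h' i' \<longleftrightarrow>
    a = a' \<and> b = b' \<and> c = c' \<and> d = d' \<and> e = e' \<and> f = f' \<and> g = g' \<and> h = h' \<and> i = i'"
  by (auto simp: mat3_eq_iff forall_3)

lemma mat3_of_mult [simp]:
  "mat3_of a b c d e f g h i ** mat3_of a' b' c' d' e' f' g' h' i' =
    mat3_of (a*a' + b*d' + c*g') (a*b' + b*e' + c*h') (a*c' + b*f' + c*i')
      (d*a' + e*d' + f*g') (d*b' + e*e' + f*h') (d*c' + e*f' + f*i')
      (g*a' + h*d' + i*g') (g*b' + h*e' + i*h') (g*c' + h*f' + i*i')"
  by (simp add: mat3_eq_iff forall_3 matrix_matrix_mult_def sum_3)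

lemma mat3_of_arith [simp]:
  "mat3_of a b c d e f g h i + mat3_of a' b' c' d' e' f' g' h' i' =
    mat3_of (a + a') (b + b') (c + c') (d + d') (e + e') (f + f') (g + g') (h + h') (i + i')"
  "mat3_of a b c d e f g h i - mat3_of a' b' c' d' e' f' g' h' i' =
    mat3_of (a - a') (b - b') (c - c') (d - d') (e - e') (f - f') (g - g') (h - h') (i - i')"
  "- mat3_of a b c d e f g h i = mat3_of (- a) (- b) (- c) (- d) (- e) (- f) (- g) (- h) (- i)"
  "r *\<^sub>R mat3_of a b c d e f g h i =
    mat3_of (r * a) (r * b) (r * c) (r * d) (r * e) (r * f) (r * g) (r * h) (r * i)"
  by (simp_all add: mat3_eq_iff forall_3)

lemma mat3_of_trace [simp]: "trace (mat3_of a b c d e f g h i) = a + e + i"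
  by (simp add: trace_def sum_3)

lemma mat3_of_det [simp]:
  "det (mat3_of a b c d e f g h i) = a*e*i + b*f*g + c*d*h - a*f*h - b*d*i - c*e*g"
  by (simp add: det_3)

lemma one_mat3_of: "(mat 1 :: mat3) = mat3_of 1 0 0 0 1 0 0 0 1"
  by (simp add: mat3_eq_iff forall_3 mat_def)

lemma zero_mat3_of: "(0 :: mat3) = mat3_of 0 0 0 0 0 0 0 0 0"
  by (simp add: mat3_eq_iff forall_3)

lemma basis_mat3_of:
  "H\<alpha> = mat3_of 1 0 0 0 (-1) 0 0 0 0"
  "H\<beta> = mat3_of 0 0 0 0 1 0 0 0 (-1)"
  "X\<alpha> = mat3_of 0 1 0 0 0 0 0 0 0"
  "X\<beta> = mat3_of 0 0 0 0 0 1 0 0 0"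
  "X\<alpha>\<beta> = mat3_of 0 0 (-1) 0 0 0 0 0 0"
  "Y\<beta> = mat3_of 0 0 0 0 0 0 0 1 0"
  "Y\<alpha>\<beta> = mat3_of 0 0 0 0 0 0 (-1) 0 0"
  by (simp_all add: mat3_eq_iff forall_3 H\<alpha>_def H\<beta>_def X\<alpha>_def X\<beta>_def X\<alpha>\<beta>_def
      Y\<beta>_def Y\<alpha>\<beta>_def E_def)

lemma span_pair_iff: "x \<in> span {A, B} \<longleftrightarrow> (\<exists>p q. x = p *\<^sub>R A + q *\<^sub>R (B :: 'a :: real_vector))"
proof -
  have "x \<in> span {A, B} \<longleftrightarrow> (\<exists>p q. x - p *\<^sub>R A = q *\<^sub>R B)"
    by (simp add: span_breakdown_eq)
  also have "\<dots> \<longleftrightarrow> (\<exists>p q. x = p *\<^sub>R A + q *\<^sub>R B)"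
    by (metis add.commute add_diff_cancel_left' diff_add_cancel)
  finally show ?thesis .
qed

lemma mem_\<uu>2_iff:
  "x \<in> \<uu>2 U1 \<longleftrightarrow> (\<exists>p q. x = mat3_of 0 p q 0 0 p 0 0 0)"
  "x \<in> \<uu>2 U2 \<longleftrightarrow> (\<exists>p q. x = mat3_of q p 0 0 q 0 0 0 (-2*q))"
  "x \<in> \<uu>2 U3 \<longleftrightarrow> (\<exists>p q. x = mat3_of 0 p q 0 0 0 0 0 0)"
  "x \<in> \<uu>2 U4 \<longleftrightarrow> (\<exists>p q. x = mat3_of 0 p 0 0 0 0 0 q 0)"
  "x \<in> \<uu>2 U5 \<longleftrightarrow> (\<exists>p q. x = mat3_of p 0 0 0 q 0 0 0 (-p-q))"
  "x \<in> \<uu>2 U6 \<longleftrightarrow> (\<exists>p q. x = mat3_of q 0 p 0 (-2*q) 0 (-p) 0 q)"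
  "x \<in> \<uu>2 U7 \<longleftrightarrow> (\<exists>p q. x = mat3_of q p 0 0 0 p 0 0 (-q))"
  "x \<in> \<uu>2 U8 \<longleftrightarrow> (\<exists>p q. x = mat3_of (-q) p (-3*q) 0 (2*q) 0 0 0 (-q))"
  "x \<in> \<uu>2 U9 \<longleftrightarrow> (\<exists>p q. x = mat3_of (-2*q) p 0 0 q 0 0 (3*q) q)"
  "x \<in> \<uu>2 (U10 a) \<longleftrightarrow> (\<exists>p q. x = mat3_of (a*q) p 0 0 ((a+1)*q) 0 0 0 (-(2*a+1)*q))"
proof -
  show "x \<in> \<uu>2 U1 \<longleftrightarrow> (\<exists>p q. x = mat3_of 0 p q 0 0 p 0 0 0)"
    by (auto simp: \<uu>2.simps span_pair_iff basis_mat3_of) (metis minus_minus)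
  show "x \<in> \<uu>2 U3 \<longleftrightarrow> (\<exists>p q. x = mat3_of 0 p q 0 0 0 0 0 0)"
    by (auto simp: \<uu>2.simps span_pair_iff basis_mat3_of) (metis minus_minus)
  show "x \<in> \<uu>2 U5 \<longleftrightarrow> (\<exists>p q. x = mat3_of p 0 0 0 q 0 0 0 (-p-q))"
  proof
    assume "x \<in> \<uu>2 U5"
    then show "\<exists>p q. x = mat3_of p 0 0 0 q 0 0 0 (-p-q)"
      by (auto simp: \<uu>2.simps span_pair_iff basis_mat3_of)
  next
    assume "\<exists>p q. x = mat3_of p 0 0 0 q 0 0 0 (-p-q)"
    then obtain p q where "x = mat3_of p 0 0 0 q 0 0 0 (-p-q)"
      by blast
    then have "x = p *\<^sub>R H\<alpha> + (p + q) *\<^sub>R H\<beta>"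
      by (simp add: basis_mat3_of)
    then show "x \<in> \<uu>2 U5"
      by (auto simp: \<uu>2.simps span_pair_iff)
  qed
qed (auto simp: \<uu>2.simps span_pair_iff basis_mat3_of algebra_simps)

declare \<uu>2.simps [simp del]

text \<open>The matrix of \<open>w\<close> in the basis formed by the columns of \<open>P\<close>.
  The inverse stands on the left, opposite to \<open>conj_action\<close>, so that successive changes
  of basis multiply as \<open>P ** Q\<close>.\<close>

definition conj_by :: "mat3 \<Rightarrow> mat3 \<Rightarrow> mat3" where
  "conj_by P w = matrix_inv P ** w ** P"

lemma matrix_inv_mult:
  assumes "det (P :: mat3) \<noteq> 0"
  shows "P ** matrix_inv P = mat 1" "matrix_inv P ** P = mat 1"
proof -
  have "\<exists>Q. P ** Q = mat 1 \<and> Q ** P = mat 1"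
    using assms by (simp add: invertible_det_nz flip: invertible_def)
  from someI_ex [OF this] show "P ** matrix_inv P = mat 1" "matrix_inv P ** P = mat 1"
    by (simp_all add: matrix_inv_def)
qed

lemma matrix_inv_eqI:
  assumes "P ** Q = mat 1" "Q ** P = mat 1"
  shows "matrix_inv (P :: mat3) = Q"
proof -
  have "det P \<noteq> 0"
    using assms invertible_det_nz invertible_def by blast
  then have "matrix_inv P ** (P ** Q) = Q"
    by (simp add: matrix_mul_assoc matrix_inv_mult)
  then show ?thesis by (simp add: assms)
qed

text \<open>Clearing the inverse lets each explicit change of basis below be checked by multiplying
  out entries.\<close>

lemma conj_by_eq_iff:
  assumes "det P \<noteq> 0"
  shows "conj_by P w = w' \<longleftrightarrow> w ** P = P ** w'"
proof
  assume "conj_by P w = w'"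
  then have "P ** w' = P ** matrix_inv P ** w ** P"
    by (auto simp: conj_by_def matrix_mul_assoc)
  then show "w ** P = P ** w'"
    by (simp add: matrix_inv_mult assms)
next
  assume "w ** P = P ** w'"
  then have "conj_by P w = matrix_inv P ** P ** w'"
    by (simp add: conj_by_def flip: matrix_mul_assoc)
  then show "conj_by P w = w'"
    by (simp add: matrix_inv_mult assms)
qed

lemma matrix_scaleR_mult:
  "A ** (c *\<^sub>R B) = c *\<^sub>R (A ** B)" "(c *\<^sub>R A) ** B = c *\<^sub>R (A ** (B :: mat3))"
  by (simp_all add: vec_eq_iff matrix_matrix_mult_def sum_distrib_left mult_ac)

lemma matrix_mult_add_rdistrib: "(A + B) ** C = A ** C + B ** (C :: mat3)"
  by (simp add: vec_eq_iff matrix_matrix_mult_def sum.distrib distrib_right)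

lemma matrix_mult_diff_distrib:
  "(- A) ** C = - (A ** C)" "(A - B) ** C = A ** C - B ** C" "C ** (A - B) = C ** A - C ** (B :: mat3)"
  by (simp_all add: vec_eq_iff matrix_matrix_mult_def sum_subtractf sum_negf algebra_simps)

lemma conj_by_hom:
  "conj_by P (x + y) = conj_by P x + conj_by P y"
  "conj_by P (x - y) = conj_by P x - conj_by P y"
  "conj_by P (- x) = - conj_by P x"
  "conj_by P (c *\<^sub>R x) = c *\<^sub>R conj_by P x"
  "conj_by P 0 = 0"
proof -
  show add: "conj_by P (x + y) = conj_by P x + conj_by P y" for x y
    by (simp add: conj_by_def matrix_add_ldistrib matrix_mult_add_rdistrib)
  show scale: "conj_by P (c *\<^sub>R x) = c *\<^sub>R conj_by P x" for c x
    by (simp add: conj_by_def matrix_scaleR_mult)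
  show neg: "conj_by P (- x) = - conj_by P x" for x
    using scale [of "-1" x] by simp
  show "conj_by P (x - y) = conj_by P x - conj_by P y"
    using add [of x "- y"] neg by simp
  show "conj_by P 0 = 0"
    using scale [of 0 0] by simp
qed

lemma conj_by_mult:
  assumes "det P \<noteq> 0"
  shows "conj_by P (x ** y) = conj_by P x ** conj_by P y"
proof -
  have "conj_by P x ** conj_by P y = matrix_inv P ** x ** (P ** matrix_inv P) ** y ** P"
    by (simp only: conj_by_def matrix_mul_assoc)
  then show ?thesis
    by (simp add: conj_by_def matrix_inv_mult assms matrix_mul_assoc)
qed

lemma conj_by_one: "det P \<noteq> 0 \<Longrightarrow> conj_by P (mat 1) = mat 1"
  by (simp add: conj_by_eq_iff)

lemma trace_conj_by: "det P \<noteq> 0 \<Longrightarrow> trace (conj_by P x) = trace x"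
  unfolding conj_by_def
  by (subst trace_mul_sym) (simp add: matrix_mul_assoc matrix_inv_mult)

lemma conj_by_inject:
  assumes "det P \<noteq> 0"
  shows "conj_by P x = conj_by P y \<longleftrightarrow> x = y"
proof
  assume "conj_by P x = conj_by P y"
  then have "x ** P = y ** P"
    using conj_by_eq_iff [OF assms] by metis
  then have "x ** (P ** matrix_inv P) = y ** (P ** matrix_inv P)"
    by (simp add: matrix_mul_assoc)
  then show "x = y"
    by (simp add: matrix_inv_mult assms)
qed simp

lemma conj_by_conj_by:
  assumes "det P \<noteq> 0" "det Q \<noteq> 0"
  shows "conj_by Q (conj_by P x) = conj_by (P ** Q) x"
proof -
  have "x ** (P ** Q) = P ** conj_by P x ** Q"
    using conj_by_eq_iff [OF assms(1), of x "conj_by P x"]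
    by (simp add: matrix_mul_assoc)
  also have "\<dots> = (P ** Q) ** conj_by Q (conj_by P x)"
    using conj_by_eq_iff [OF assms(2), of "conj_by P x" "conj_by Q (conj_by P x)"]
    by (simp flip: matrix_mul_assoc)
  finally show ?thesis
    using assms by (metis conj_by_eq_iff det_mul mult_eq_0_iff)
qed

lemma SL3_conjugate_iff:
  "\<uu> \<sim>\<^sub>S\<^sub>L \<vv> \<longleftrightarrow> (\<exists>P. det P \<noteq> 0 \<and> \<vv> = conj_by P ` \<uu>)"
proof
  assume "\<uu> \<sim>\<^sub>S\<^sub>L \<vv>"
  then obtain g where g: "det g = 1" "\<vv> = conj_action g \<uu>"
    by (auto simp: SL3_conjugate_def SL3_def)
  define P where "P = matrix_inv g"
  have P: "g ** P = mat 1" "P ** g = mat 1"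
    using g by (simp_all add: P_def matrix_inv_mult)
  then have "det P \<noteq> 0"
    unfolding invertible_det_nz [symmetric] invertible_def by blast
  moreover have "matrix_inv P = g"
    by (rule matrix_inv_eqI [OF P(2,1)])
  ultimately  show "\<exists>P. det P \<noteq> 0 \<and> \<vv> = conj_by P ` \<uu>"
    using g(2) unfolding conj_by_def conj_action_def P_def by metis
next
  assume "\<exists>P. det P \<noteq> 0 \<and> \<vv> = conj_by P ` \<uu>"
  then obtain P where P: "det P \<noteq> 0" "\<vv> = conj_by P ` \<uu>"
    by blast
  \<comment> \<open>The real cube root exists whatever the sign of \<open>det P\<close>. With it
    \<open>det g = c ^ 3 / det P = 1\<close>, and the scalar \<open>c\<close> cancels in
    \<open>g ** x ** matrix_inv g\<close>.\<close>
  define c where "c = root 3 (det P)"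
  have c: "c ^ 3 = det P" "c \<noteq> 0"
    using P(1) by (auto simp: c_def odd_real_root_pow)
  define g where "g = c *\<^sub>R matrix_inv P"
  have inv: "matrix_inv g = inverse c *\<^sub>R P"
    by (rule matrix_inv_eqI) (use P c in \<open>simp_all add: g_def matrix_scaleR_mult matrix_inv_mult\<close>)
  have "det (matrix_inv P) * det P = 1"
    using P(1) by (simp add: matrix_inv_mult flip: det_mul)
  moreover have "det (c *\<^sub>R A) = c ^ 3 * det A" for A :: mat3
    by (cases A) (simp add: power3_eq_cube algebra_simps)
  ultimately have "g \<in> SL3"
    by (simp add: SL3_def g_def c mult.commute)
  moreover have "g ** x ** matrix_inv g = conj_by P x" for x
    using c(2) by (simp add: inv) (simp add: g_def matrix_scaleR_mult conj_by_def)
  ultimately show "\<uu> \<sim>\<^sub>S\<^sub>L \<vv>"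
    using P(2) unfolding SL3_conjugate_def conj_action_def by (metis (no_types, lifting) image_cong)
qed

lemma lie_subalgebra_conj_by:
  assumes "det P \<noteq> 0" "lie_subalgebra_sl3 \<uu>"
  shows "lie_subalgebra_sl3 (conj_by P ` \<uu>)" "dim (conj_by P ` \<uu>) = dim \<uu>"
proof -
  have lin: "linear (conj_by P)"
    by (simp add: linear_iff conj_by_hom)
  show "lie_subalgebra_sl3 (conj_by P ` \<uu>)"
    using assms linear_subspace_image [OF lin]
    by (auto simp: lie_subalgebra_sl3_def sl3_def trace_conj_by bracket_def
        simp flip: conj_by_mult conj_by_hom(2))
  show "dim (conj_by P ` \<uu>) = dim \<uu>"
    by (rule dim_image_eq [OF lin]) (simp add: inj_on_def conj_by_inject assms)
qed

lemma subspace_eq_span_pair: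
  assumes "subspace \<uu>" "dim \<uu> = 2" "\<uu> \<subseteq> span {A, B :: 'a :: euclidean_space}"
  shows "\<uu> = span {A, B}"
proof (rule subspace_dim_equal)
  have "dim (span {A, B}) \<le> card {A, B}"
    by (intro dim_le_card) auto
  also have "\<dots> \<le> 2"
    by (simp add: card_insert_if)
  finally show "dim (span {A, B}) \<le> dim \<uu>"
    using assms by simp
qed (use assms in auto)

lemma \<uu>2_span: "\<exists>A B. \<uu>2 l = span {A, B}"
  by (cases l) (auto simp: \<uu>2.simps)

section \<open>Reduction of the classification to containment in a list entry\<close>

definition classified :: "mat3 set \<Rightarrow> bool" where
  "classified \<uu> \<longleftrightarrow> (\<exists>l. \<uu> \<sim>\<^sub>S\<^sub>L \<uu>2 l)"

lemma classified_conj_by: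
  assumes "det P \<noteq> 0" "classified (conj_by P ` \<uu>)"
  shows "classified \<uu>"
proof -
  obtain l Q where Q: "det Q \<noteq> 0" "\<uu>2 l = conj_by Q ` conj_by P ` \<uu>"
    using assms(2) unfolding classified_def SL3_conjugate_iff by blast
  then have "\<uu>2 l = conj_by (P ** Q) ` \<uu>" "det (P ** Q) \<noteq> 0"
    using assms(1) by (simp_all add: image_image conj_by_conj_by det_mul)
  then show ?thesis
    unfolding classified_def SL3_conjugate_iff by blast
qed

text \<open>Each entry is spanned by two elements, so a two-dimensional \<open>\<uu>\<close> inside
  it already fills it.\<close>

lemma classified_if_subset:
  assumes "lie_subalgebra_sl3 \<uu>" "dim \<uu> = 2" "\<And>x. x \<in> \<uu> \<Longrightarrow> x \<in> \<uu>2 l"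
  shows "classified \<uu>"
proof -
  obtain A B where "\<uu>2 l = span {A, B}"
    using \<uu>2_span by blast
  then have "\<uu> = \<uu>2 l"
    using assms subspace_eq_span_pair [of \<uu> A B] by (auto simp: lie_subalgebra_sl3_def)
  moreover have "\<uu> = conj_by (mat 1) ` \<uu>"
    by (simp add: conj_by_def matrix_inv_eqI [of "mat 1" "mat 1"])
  ultimately show ?thesis
    unfolding classified_def SL3_conjugate_iff by (metis det_I zero_neq_one)
qed

section \<open>Cyclic vectors\<close>

definition cols3 :: "real ^ 3 \<Rightarrow> real ^ 3 \<Rightarrow> real ^ 3 \<Rightarrow> mat3" where
  "cols3 u v w = mat3_of (u$1) (v$1) (w$1) (u$2) (v$2) (w$2) (u$3) (v$3) (w$3)"

lemma mat3_of_mult_vector: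
  "mat3_of a b c d e f g h i *v v = vector
    [a * v$1 + b * v$2 + c * v$3, d * v$1 + e * v$2 + f * v$3, g * v$1 + h * v$2 + i * v$3]"
  by (simp add: vec_eq_iff forall_3 matrix_vector_mult_def sum_3)

lemma vector_eq_iff3:
  "(vector [a, b, c] :: real ^ 3) = vector [a', b', c'] \<longleftrightarrow> a = a' \<and> b = b' \<and> c = c'"
  by (auto simp: vec_eq_iff forall_3)

lemma mult_cols3: "A ** cols3 u v w = cols3 (A *v u) (A *v v) (A *v w)"
  by (cases A) (simp add: cols3_def mat3_of_mult_vector)

lemma cols3_mult:
  "cols3 u v w ** mat3_of a b c d e f g h i =
    cols3 (a *\<^sub>R u + d *\<^sub>R v + g *\<^sub>R w) (b *\<^sub>R u + e *\<^sub>R v + h *\<^sub>R w) (c *\<^sub>R u + f *\<^sub>R v + i *\<^sub>R w)"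
  by (simp add: cols3_def algebra_simps)

lemma cols3_mult_vector: "cols3 u v w *v x = x$1 *\<^sub>R u + x$2 *\<^sub>R v + x$3 *\<^sub>R w"
  by (simp add: cols3_def mat3_of_mult_vector vec_eq_iff forall_3 algebra_simps)

text \<open>The cross product completes \<open>v\<close> and \<open>w\<close> to a basis: the
  determinant is its squared length, which vanishes only for collinear vectors.\<close>

lemma det_cols3_cross:
  assumes "v \<noteq> 0" "\<And>c. w \<noteq> c *\<^sub>R v"
  shows "\<exists>f. det (cols3 v w f) \<noteq> 0"
proof
  have "cross3 v w \<noteq> 0"
  proof
    assume "cross3 v w = 0"
    then have "v = 0 \<or> w = 0 \<or> (\<exists>c. w = c *\<^sub>R v)"
      by (simp add: cross_eq_0 collinear_lemma)
    then show False
      using assms assms(2) [of 0] by auto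
  qed
  moreover have "det (cols3 v w (cross3 v w)) = cross3 v w \<bullet> cross3 v w"
    by (simp add: cols3_def cross3_def inner_vec_def sum_3 algebra_simps)
  ultimately show "det (cols3 v w (cross3 v w)) \<noteq> 0"
    by simp
qed

text \<open>Here \<open>u\<close> and \<open>w\<close> are the coordinates, in the basis of columns
  of \<open>P\<close>, of a vector and of its image under \<open>x\<close>.\<close>

lemma conj_by_mult_vector:
  assumes "det P \<noteq> 0" "x *v (P *v u) = P *v w"
  shows "conj_by P x *v u = w"
proof -
  have "conj_by P x *v u = (matrix_inv P ** P) *v w"
    unfolding conj_by_def using assms(2) by (simp flip: matrix_vector_mul_assoc)
  then show ?thesis
    by (simp add: matrix_inv_mult assms)
qed

text \<open>For trace 0 the second elementary symmetric function of the eigenvalues is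
  \<open>- trace (x ** x) / 2\<close>.\<close>

lemma cayley_hamilton_trace_0:
  assumes "trace (x :: mat3) = 0"
  shows "x ** x ** x = (trace (x ** x) / 2) *\<^sub>R x + det x *\<^sub>R mat 1"
proof (cases x)
  case (1 a b c d e f g h i)
  then have "i = - a - e"
    using assms by simp
  then show ?thesis
    by (simp add: 1 one_mat3_of) (simp add: field_simps)
qed

text \<open>Companion matrix of \<open>t ^ 3 + c * t + d\<close>, the shape of the characteristic
  polynomial of a traceless matrix.\<close>

definition companion :: "real \<Rightarrow> real \<Rightarrow> mat3" where
  "companion c d = mat3_of 0 0 (- d) 1 0 (- c) 0 1 0"

lemma not_cyclic_normal_form:
  assumes "\<And>v. det (cols3 v (X *v v) (X *v (X *v v))) = 0" "trace X = 0"
    and "X *v vector [1, 0, 0] = vector [0, 1, 0]"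
  shows "\<exists>a. X ** X = (2 * a\<^sup>2) *\<^sub>R mat 1 - a *\<^sub>R X"
proof (cases X)
  case (1 a b c d e f g h i)
  have adg: "a = 0" "d = 1" "g = 0" and i: "i = - e"
    using assms(2,3) by (auto simp: 1 mat3_of_mult_vector vector_eq_iff3)
  have D: "det (cols3 v (X *v v) (X *v (X *v v))) = 0" for v
    by (rule assms)
  have h: "h = 0"
    using D [of "vector [1, 0, 0]"] by (simp add: 1 adg mat3_of_mult_vector cols3_def)
  \<comment> \<open>The determinant for the vector \<open>(s, 0, 1)\<close> is quadratic in
    \<open>s\<close>, so its values at 0, 1, -1 give all coefficients. The leading one yields
    \<open>b\<close>, the linear one \<open>e * (c - e * f) = 0\<close>. If \<open>e = 0\<close>,
    then \<open>b = 0\<close> and the constant one gives \<open>c = 0\<close>.\<close>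
  have Q: "(c + e * s)\<^sup>2 + e * (c + e * s) * (f + s) - b * (f + s)\<^sup>2 = 0" for s
    using D [of "vector [s, 0, 1]"]
    by (simp add: 1 adg h i mat3_of_mult_vector cols3_def) algebra
  have b: "b = 2 * e\<^sup>2"
    using Q [of 0] Q [of 1] Q [of "-1"] by algebra
  have "e * (c - e * f) = 0" "c\<^sup>2 + e * c * f - b * f\<^sup>2 = 0"
    using Q [of 0] Q [of 1] b by algebra+
  then have "c = e * f"
    using b by (cases "e = 0") auto
  then have "X ** X = (2 * (- e)\<^sup>2) *\<^sub>R mat 1 - (- e) *\<^sub>R X"
    by (simp add: 1 adg h i b one_mat3_of power2_eq_square algebra_simps)
  then show ?thesis ..
qed

text \<open>A cyclic vector \<open>v\<close> gives the companion form in the basis \<open>v\<close>,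
  \<open>x v\<close>, \<open>x x v\<close>. Without one, any \<open>v\<close> that is not an
  eigenvector starts a basis in which \<open>not_cyclic_normal_form\<close> applies. If every vector
  is an eigenvector, \<open>x\<close> is scalar, hence 0.\<close>

lemma companion_or_quadratic:
  assumes "trace x = 0"
  obtains (cyclic) P c d where "det P \<noteq> 0" "conj_by P x = companion c d"
  | (quadratic) a where "x ** x = (2 * a\<^sup>2) *\<^sub>R mat 1 - a *\<^sub>R x"
proof (cases "\<exists>v. det (cols3 v (x *v v) (x *v (x *v v))) \<noteq> 0")
  case True
  then obtain v where v: "det (cols3 v (x *v v) (x *v (x *v v))) \<noteq> 0" (is "det ?P \<noteq> 0")
    by blast
  define c d where "c = - trace (x ** x) / 2" and "d = - det x"
  have "x *v (x *v (x *v v)) = (x ** x ** x) *v v"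
    by (simp add: matrix_vector_mul_assoc matrix_mul_assoc)
  also have "\<dots> = - (d *\<^sub>R v) - c *\<^sub>R (x *v v)"
    by (simp add: cayley_hamilton_trace_0 assms c_def d_def matrix_vector_mult_add_rdistrib
        flip: scaleR_matrix_vector_assoc)
  finally have "x ** ?P = ?P ** companion c d"
    by (simp add: mult_cols3 companion_def cols3_mult)
  then show ?thesis
    using v cyclic by (simp add: conj_by_eq_iff)
next
  case False
  then have D: "det (cols3 v (x *v v) (x *v (x *v v))) = 0" for v
    by blast
  show ?thesis
  proof (cases "\<exists>v. v \<noteq> 0 \<and> (\<forall>c. x *v v \<noteq> c *\<^sub>R v)")
    case True
    then obtain v f where P: "det (cols3 v (x *v v) f) \<noteq> 0" (is "det ?P \<noteq> 0")
      using det_cols3_cross by metis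
    define X where "X = conj_by ?P x"
    have xP: "x *v (?P *v u) = ?P *v (X *v u)" for u
      using conj_by_eq_iff [OF P, of x X] by (simp add: X_def matrix_vector_mul_assoc)
    have "det (cols3 w (X *v w) (X *v (X *v w))) = 0" for w
    proof -
      have "?P ** cols3 w (X *v w) (X *v (X *v w)) =
          cols3 (?P *v w) (x *v (?P *v w)) (x *v (x *v (?P *v w)))"
        by (simp add: mult_cols3 xP)
      then have "det ?P * det (cols3 w (X *v w) (X *v (X *v w))) = 0"
        using D by (simp flip: det_mul)
      then show ?thesis
        using P by simp
    qed
    moreover have "trace X = 0"
      using P assms by (simp add: X_def trace_conj_by)
    moreover have "X *v vector [1, 0, 0] = vector [0, 1, 0]"
      unfolding X_def using P by (intro conj_by_mult_vector) (simp_all add: cols3_mult_vector)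
    ultimately obtain a where "X ** X = (2 * a\<^sup>2) *\<^sub>R mat 1 - a *\<^sub>R X"
      using not_cyclic_normal_form by blast
    then have "conj_by ?P (x ** x) = conj_by ?P ((2 * a\<^sup>2) *\<^sub>R mat 1 - a *\<^sub>R x)"
      using P by (simp add: conj_by_mult conj_by_hom conj_by_one X_def)
    then show ?thesis
      using quadratic P by (simp add: conj_by_inject)
  next
    case False
    then have ev: "\<exists>c. x *v v = c *\<^sub>R v" if "v \<noteq> 0" for v
      using that by blast
    have "x = 0"
    proof (cases x)
      case (1 a b c d e f g h i)
      have scale: "r *\<^sub>R vector [p, q, s] = (vector [r * p, r * q, r * s] :: real ^ 3)" for r p q s
        by (simp add: vec_eq_iff forall_3)
      have nz: "vector [p, q, s] \<noteq> (0 :: real ^ 3) \<longleftrightarrow> p \<noteq> 0 \<or> q \<noteq> 0 \<or> s \<noteq> 0" for p q s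
        by (auto simp: vec_eq_iff forall_3)
      show ?thesis
        \<comment> \<open>The unit vectors make \<open>x\<close> diagonal, the all-ones vector makes
          its diagonal constant, and the trace makes it 0.\<close>
        using ev [of "vector [1, 0, 0]"] ev [of "vector [0, 1, 0]"] ev [of "vector [0, 0, 1]"]
          ev [of "vector [1, 1, 1]"] assms
        by (auto simp: 1 nz scale mat3_of_mult_vector vector_eq_iff3 zero_mat3_of)
    qed
    then show ?thesis
      using quadratic [of 0] by simp
  qed
qed

text \<open>In a basis \<open>z v\<close>, \<open>v\<close>, \<open>f\<close> the first two columns
  are 0 and the first unit vector, and the vanishing square leaves only the top entry
  \<open>p\<close> in the third.\<close>

lemma square_zero_conj:
  assumes "z ** z = 0" "z \<noteq> 0"
  shows "\<exists>P. det P \<noteq> 0 \<and> conj_by P z = X\<alpha>"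
proof -
  obtain v where v: "z *v v \<noteq> 0"
    using assms(2) by (metis matrix_eq matrix_vector_mult_0)
  have zz: "z *v (z *v u) = 0" for u
    by (simp add: matrix_vector_mul_assoc assms(1))
  have "v \<noteq> c *\<^sub>R (z *v v)" for c
    using v zz by (metis matrix_vector_mult_scaleR scaleR_zero_right)
  then obtain f where P: "det (cols3 (z *v v) v f) \<noteq> 0" (is "det ?P \<noteq> 0")
    using det_cols3_cross v by blast
  define X where "X = conj_by ?P z"
  have XX: "X ** X = 0"
    using P by (simp add: X_def assms(1) conj_by_hom flip: conj_by_mult)
  have X1: "X *v vector [1, 0, 0] = vector [0, 0, 0]" and X2: "X *v vector [0, 1, 0] = vector [1, 0, 0]"
    unfolding X_def using P
    by (intro conj_by_mult_vector; simp add: cols3_mult_vector zz)+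
  obtain p where X: "X = mat3_of 0 1 p 0 0 0 0 0 0"
  proof (cases X)
    case (1 a b c d e f g h i)
    then show thesis
      using XX X1 X2 that by (auto simp: mat3_of_mult_vector vector_eq_iff3 zero_mat3_of)
  qed
  \<comment> \<open>Replaces the third basis vector \<open>f\<close> by \<open>f - p v\<close>,
    which \<open>z\<close> kills.\<close>
  define Q where "Q = mat3_of 1 0 0 0 1 (- p) 0 0 1"
  have Q: "det Q \<noteq> 0" "conj_by Q X = X\<alpha>"
    by (simp_all add: Q_def) (simp add: X conj_by_eq_iff basis_mat3_of)
  then have "det (?P ** Q) \<noteq> 0 \<and> conj_by (?P ** Q) z = X\<alpha>"
    using P by (simp add: X_def det_mul conj_by_conj_by)
  then show ?thesis ..
qed

section \<open>Non-abelian subalgebras\<close>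

lemma span_pair_eqI:
  assumes "subspace \<uu>" "dim \<uu> = 2" "x \<in> \<uu>" "y \<in> \<uu>" "x \<noteq> 0" "\<And>c. y \<noteq> c *\<^sub>R (x :: 'a :: euclidean_space)"
  shows "\<uu> = span {x, y}"
proof -
  have "y \<notin> span {x}"
    using assms(6) by (auto simp: span_breakdown_eq)
  then have "independent {y, x}" "y \<noteq> x"
    using assms(5) assms(6) [of 1] by (simp_all add: independent_insert)
  then have "dim (span {x, y}) = 2"
    by (simp add: dim_eq_card_independent insert_commute)
  moreover have "span {x, y} \<subseteq> \<uu>"
    using assms by (simp add: span_minimal)
  ultimately show ?thesis
    using assms(1,2) by (metis dim_span order_refl subspace_dim_equal subspace_span)
qed

lemma classified_pair:
  assumes \<uu>: "lie_subalgebra_sl3 \<uu>" "dim \<uu> = 2"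
    and xy: "x \<in> \<uu>" "y \<in> \<uu>" "x \<noteq> 0" "\<And>c. y \<noteq> c *\<^sub>R x"
    and P: "det P \<noteq> 0" "conj_by P x \<in> \<uu>2 l" "conj_by P y \<in> \<uu>2 l"
  shows "classified \<uu>"
proof (rule classified_conj_by [OF P(1)], rule classified_if_subset)
  show "lie_subalgebra_sl3 (conj_by P ` \<uu>)" "dim (conj_by P ` \<uu>) = 2"
    using lie_subalgebra_conj_by P(1) \<uu> by simp_all
  have "subspace (\<uu>2 l)"
    by (metis \<uu>2_span subspace_span)
  moreover have "\<uu> = span {x, y}"
    using \<uu> xy by (intro span_pair_eqI) (auto simp: lie_subalgebra_sl3_def)
  ultimately show "w \<in> \<uu>2 l" if "w \<in> conj_by P ` \<uu>" for w
    using that P(2,3) by (auto simp: span_pair_iff conj_by_hom subspace_add subspace_mul)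
qed

lemma trace_scaleR: "trace (c *\<^sub>R A) = c * trace (A :: mat3)"
  by (cases A) (simp add: algebra_simps)

text \<open>Reversing the order of the basis turns the lower shift into the upper one.\<close>

lemma conj_companion_0:
  "\<exists>Q. det Q \<noteq> 0 \<and> conj_by Q (companion 0 0) = mat3_of 0 1 0 0 0 1 0 0 0"
proof -
  define Q where "Q = mat3_of 0 0 1 0 1 0 1 0 0"
  have "det Q \<noteq> 0" "conj_by Q (companion 0 0) = mat3_of 0 1 0 0 0 1 0 0 0"
    by (simp_all add: Q_def conj_by_eq_iff companion_def)
  then show ?thesis by blast
qed

text \<open>If \<open>w\<close> commutes with \<open>z\<close>, then \<open>z ** w\<close> is the
  commutator of \<open>z\<close> and \<open>h ** w\<close>, so its trace is 0. For
  \<open>w = z\<close> this reduces Cayley-Hamilton to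
  \<open>z ** z ** z = det z *\<^sub>R mat 1\<close>; for \<open>w = z ** z\<close> the trace then
  forces \<open>det z = 0\<close>.\<close>

lemma eigenvector_ad_nilpotent:
  assumes "h ** z - z ** h = - z" "trace (z :: mat3) = 0"
  shows "z ** z ** z = 0" "trace (z ** z) = 0"
proof -
  have "z + h ** z = z ** h"
    using assms(1) by (simp add: diff_eq_eq)
  then have z: "z ** w + h ** z ** w = z ** h ** w" for w :: mat3
    by (simp flip: matrix_mult_add_rdistrib)
  have comm: "trace (z ** w) = 0" if "z ** w = w ** z" for w :: mat3
  proof -
    have "h ** z ** w = h ** w ** z"
      by (simp add: that flip: matrix_mul_assoc)
    then have "trace (h ** z ** w) = trace (z ** h ** w)"
      using trace_mul_sym [of "h ** w" z] by (simp add: matrix_mul_assoc)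
    then show ?thesis
      using arg_cong [OF z [of w], of trace] by (simp add: trace_add)
  qed
  show 2: "trace (z ** z) = 0"
    by (rule comm) simp
  have 3: "trace (z ** z ** z) = 0"
    using comm [of "z ** z"] by (simp add: matrix_mul_assoc)
  have CH: "z ** z ** z = det z *\<^sub>R mat 1"
    using cayley_hamilton_trace_0 [OF assms(2)] 2 by simp
  then have "det z = 0"
    using 3 by (simp add: one_mat3_of)
  then show "z ** z ** z = 0"
    using CH by simp
qed

lemma classified_ad_eigenvector:
  assumes \<uu>: "lie_subalgebra_sl3 \<uu>" "dim \<uu> = 2"
    and hz: "h \<in> \<uu>" "z \<in> \<uu>" "z \<noteq> 0" "h ** z - z ** h = - z"
  shows "classified \<uu>"
proof -
  have tr: "trace z = 0" "trace h = 0"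
    using \<uu>(1) hz(1,2) by (auto simp: lie_subalgebra_sl3_def sl3_def)
  note nil = eigenvector_ad_nilpotent [OF hz(4) tr(1)]
  have "h \<noteq> c *\<^sub>R z" for c
    using hz(3,4) by (auto simp: matrix_scaleR_mult)
  note pair = classified_pair [OF \<uu> hz(2,1,3) this]
  have conj_h: "conj_by P h ** conj_by P z - conj_by P z ** conj_by P h = - conj_by P z"
    "trace (conj_by P h) = 0" if "det P \<noteq> 0" for P
    using that hz(4) tr(2) by (simp_all add: trace_conj_by flip: conj_by_mult conj_by_hom(2,3))
  consider (regular) P c d where "det P \<noteq> 0" "conj_by P z = companion c d"
    | (quadratic) a where "z ** z = (2 * a\<^sup>2) *\<^sub>R mat 1 - a *\<^sub>R z"
    using companion_or_quadratic [OF tr(1)] by blast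
  then show ?thesis
  proof cases
    case regular
    have "companion c d ** companion c d ** companion c d = 0"
      using nil(1) regular(1) by (simp add: conj_by_hom(5) flip: regular(2) conj_by_mult)
    then have "c = 0" "d = 0"
      by (simp_all add: companion_def zero_mat3_of)
    then obtain Q where Q: "det Q \<noteq> 0" "conj_by Q (conj_by P z) = mat3_of 0 1 0 0 0 1 0 0 0"
      using conj_companion_0 regular by auto
    define R where "R = P ** Q"
    have R: "det R \<noteq> 0" "conj_by R z = mat3_of 0 1 0 0 0 1 0 0 0"
      using Q regular(1) by (simp_all add: R_def det_mul conj_by_conj_by)
    obtain b c where h: "conj_by R h = mat3_of (-1) b c 0 0 b 0 0 1"
    proof (cases "conj_by R h")
      case (1 a b c d e f g h i)
      then show thesis
        using conj_h [OF R(1)] that by (auto simp: R(2))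
    qed
    \<comment> \<open>\<open>S\<close> commutes with the shift. The diagonal entries -1 and 1 of the
      conjugated \<open>h\<close> differ by 2, so the shear \<open>c/2\<close> removes the corner
      entry \<open>c\<close>.\<close>
    define S where "S = mat3_of 1 0 (c/2) 0 1 0 0 0 1"
    have S: "det S \<noteq> 0" "conj_by S (conj_by R z) = mat3_of 0 1 0 0 0 1 0 0 0"
      "conj_by S (conj_by R h) = mat3_of (-1) b 0 0 0 b 0 0 1"
      by (simp_all add: S_def R(2) h conj_by_eq_iff)
    show ?thesis
    proof (rule pair)
      show "det (R ** S) \<noteq> 0"
        using R S by (simp add: det_mul)
      show "conj_by (R ** S) z \<in> \<uu>2 U7" "conj_by (R ** S) h \<in> \<uu>2 U7"
        using R(1) S by (simp_all add: mem_\<uu>2_iff flip: conj_by_conj_by)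
    qed
  next
    case quadratic
    then have "trace (z ** z) = 6 * a\<^sup>2"
      using tr by (simp add: one_mat3_of trace_sub trace_scaleR)
    then have "z ** z = 0"
      using nil(2) quadratic by simp
    then obtain P where P: "det P \<noteq> 0" "conj_by P z = X\<alpha>"
      using square_zero_conj hz(3) by blast
    obtain a b c e where h: "conj_by P h = mat3_of a b c 0 (a + 1) 0 0 e (- 2 * a - 1)"
    proof (cases "conj_by P h")
      case (1 a b c d e f g h i)
      then have "e = a + 1" "i = - 2 * a - 1" "d = 0" "f = 0" "g = 0"
        using conj_h [OF P(1)] by (auto simp: P(2) basis_mat3_of)
      then show thesis
        using that 1 by simp
    qed
    have fin: "classified \<uu>"
      if "k \<noteq> 0" "mat3_of a (b + c * t - s * (e - (3 * a + 2) * t) / k)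
        (k * c + (3 * a + 1) * s) 0 (a + 1) 0 0 ((e - (3 * a + 2) * t) / k) (- 2 * a - 1) \<in> \<uu>2 l"
      "X\<alpha> \<in> \<uu>2 l" for s t k l
    proof -
      \<comment> \<open>\<open>Q\<close> commutes with \<open>X\<alpha>\<close>. The parameter
        \<open>s\<close> changes the (1,3) entry by a multiple of \<open>3 * a + 1\<close>,
        \<open>t\<close> the (3,2) entry by a multiple of \<open>3 * a + 2\<close>, and
        \<open>k\<close> rescales. Both factors are differences of diagonal entries of the
        conjugated \<open>h\<close>.\<close>
      define Q where "Q = mat3_of 1 0 s 0 1 0 0 t k"
      have Q: "det Q \<noteq> 0" "conj_by Q X\<alpha> = X\<alpha>"
        "conj_by Q (conj_by P h) = mat3_of a (b + c * t - s * (e - (3 * a + 2) * t) / k)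
        (k * c + (3 * a + 1) * s) 0 (a + 1) 0 0 ((e - (3 * a + 2) * t) / k) (- 2 * a - 1)"
        using that(1) by (simp_all add: Q_def h conj_by_eq_iff basis_mat3_of) (auto simp: field_simps)
      show ?thesis
      proof (rule pair)
        show "det (P ** Q) \<noteq> 0"
          using P Q by (simp add: det_mul)
        show "conj_by (P ** Q) z \<in> \<uu>2 l" "conj_by (P ** Q) h \<in> \<uu>2 l"
          using P Q that by (simp_all flip: conj_by_conj_by)
      qed
    qed
    have X: "X\<alpha> \<in> \<uu>2 U8" "X\<alpha> \<in> \<uu>2 U9" "X\<alpha> \<in> \<uu>2 (U10 a)"
      by (simp_all add: \<uu>2.simps span_base)
    \<comment> \<open>At \<open>a = - 1/3\<close> and \<open>a = - 2/3\<close> one of the two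
      factors vanishes. A nonzero \<open>c\<close> or \<open>e\<close> then survives and is scaled
      to -1 or 1, which gives U8 or U9; otherwise both entries are cleared.\<close>
    consider "a \<noteq> - 1/3" "a \<noteq> - 2/3" | "a = - 1/3" "c = 0" | "a = - 1/3" "c \<noteq> 0"
      | "a = - 2/3" "e = 0" | "a = - 2/3" "e \<noteq> 0"
      by blast
    then show ?thesis
    proof cases
      case 1
      then have "3 * a + 1 \<noteq> 0" "3 * a + 2 \<noteq> 0"
        by auto
      then show ?thesis
        by (intro fin [of 1 "e / (3 * a + 2)" "- c / (3 * a + 1)" "U10 a"] X)
          (auto simp: mem_\<uu>2_iff intro!: exI [of _ 1])
    next
      case 2
      then show ?thesis
        by (intro fin [of 1 e 0 "U10 a"] X) (auto simp: mem_\<uu>2_iff intro!: exI [of _ 1])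
    next
      case 3
      then show ?thesis
        by (intro fin [of "- 1 / c" e 0 U8] X) (auto simp: mem_\<uu>2_iff intro!: exI [of _ "1/3"])
    next
      case 4
      then show ?thesis
        by (intro fin [of 1 0 c "U10 a"] X) (auto simp: mem_\<uu>2_iff intro!: exI [of _ 1])
    next
      case 5
      then show ?thesis
        by (intro fin [of e 0 "e * c" U9] X) (auto simp: mem_\<uu>2_iff intro!: exI [of _ "1/3"])
    qed
  qed
qed

text \<open>If \<open>w = [x, y] = p x + q y\<close>, then \<open>[x, w] = q w\<close> and
  \<open>[y, w] = - p w\<close>. Since \<open>w\<close> is nonzero, \<open>p\<close> or
  \<open>q\<close> is, and a multiple of \<open>y\<close> or \<open>x\<close> serves as
  \<open>h\<close>.\<close>

lemma classified_nonabelian: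
  assumes \<uu>: "lie_subalgebra_sl3 \<uu>" "dim \<uu> = 2"
    and xy: "x \<in> \<uu>" "y \<in> \<uu>" "x ** y \<noteq> y ** x"
  shows "classified \<uu>"
proof -
  have sub: "subspace \<uu>" and "bracket x y \<in> \<uu>"
    using \<uu>(1) xy by (auto simp: lie_subalgebra_sl3_def)
  define w where "w = bracket x y"
  have w: "w \<in> \<uu>" "w \<noteq> 0"
    using \<open>bracket x y \<in> \<uu>\<close> xy(3) by (simp_all add: w_def bracket_def)
  have "x \<noteq> 0" "y \<noteq> c *\<^sub>R x" for c
    using xy(3) by (auto simp: matrix_scaleR_mult)
  then have "\<uu> = span {x, y}"
    using span_pair_eqI [OF sub \<uu>(2) xy(1,2)] by blast
  then obtain p q where pq: "w = p *\<^sub>R x + q *\<^sub>R y"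
    using w(1) by (auto simp: span_pair_iff)
  have br: "bracket x w = q *\<^sub>R w" "bracket y w = - p *\<^sub>R w"
  proof -
    have "bracket x (p *\<^sub>R x + q *\<^sub>R y) = q *\<^sub>R bracket x y"
      "bracket y (p *\<^sub>R x + q *\<^sub>R y) = - p *\<^sub>R bracket x y"
      by (simp_all add: bracket_def matrix_add_ldistrib matrix_mult_add_rdistrib
          matrix_scaleR_mult algebra_simps)
    then show "bracket x w = q *\<^sub>R w" "bracket y w = - p *\<^sub>R w"
      unfolding pq [symmetric] w_def [symmetric] by simp_all
  qed
  have scale: "bracket (c *\<^sub>R A) B = c *\<^sub>R bracket A B" for c A B
    by (simp add: bracket_def matrix_scaleR_mult algebra_simps)
  have "\<exists>h\<in>\<uu>. bracket h w = - w"
  proof (cases "p = 0")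
    case True
    then have "q \<noteq> 0"
      using pq w(2) by auto
    then have "bracket ((- 1 / q) *\<^sub>R x) w = - w"
      by (simp only: scale br) simp
    then show ?thesis
      using sub xy(1) subspace_mul by blast
  next
    case False
    then have "bracket ((1 / p) *\<^sub>R y) w = - w"
      by (simp only: scale br) simp
    then show ?thesis
      using sub xy(2) subspace_mul by blast
  qed
  then show ?thesis
    using classified_ad_eigenvector [OF \<uu>] w by (auto simp: bracket_def)
qed

section \<open>Abelian subalgebras\<close>

lemma depressed_cubic_root: "\<exists>r :: real. r ^ 3 + c * r + d = 0"
proof -
  define f where "f t = t ^ 3 + c * t + d" for t
  \<comment> \<open>Chosen so that \<open>T ^ 3\<close> dominates \<open>T * T\<close>, which in
    turn dominates \<open>\<bar>c\<bar> * T + \<bar>d\<bar>\<close>.\<close>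
  define T where "T = 1 + \<bar>c\<bar> + \<bar>d\<bar>"
  have "T \<ge> 1" "\<bar>d\<bar> \<le> T"
    by (simp_all add: T_def)
  have "T * T \<le> T * T * T"
    using \<open>T \<ge> 1\<close> mult_left_mono [of 1 T "T * T"] by simp
  moreover have "T * T = T + \<bar>c\<bar> * T + \<bar>d\<bar> * T"
    by (simp add: T_def algebra_simps)
  moreover have "\<bar>d\<bar> \<le> \<bar>d\<bar> * T"
    using \<open>T \<ge> 1\<close> mult_left_mono [of 1 T "\<bar>d\<bar>"] by simp
  moreover have "\<bar>c * T\<bar> = \<bar>c\<bar> * T"
    using \<open>T \<ge> 1\<close> by (simp add: abs_mult)
  ultimately have "\<bar>c * T\<bar> + \<bar>d\<bar> \<le> T * T * T"
    using \<open>T \<ge> 1\<close> by linarith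
  then have "f (- T) \<le> 0" "0 \<le> f T"
    by (auto simp: f_def power3_eq_cube)
  moreover have "- T \<le> T"
    using \<open>T \<ge> 1\<close> by simp
  moreover have "continuous_on {- T..T} f"
    unfolding f_def by (intro continuous_intros)
  ultimately show ?thesis
    using IVT' [of f "- T" 0 T] by (auto simp: f_def)
qed

text \<open>The conjugated subalgebra lies in the traceless commutant of the normal form
  \<open>D\<close>. By dimension, containment of that commutant in an entry is enough.\<close>

lemma classified_commutant:
  assumes \<uu>: "lie_subalgebra_sl3 \<uu>" "dim \<uu> = 2"
    and comm: "\<And>w. w \<in> \<uu> \<Longrightarrow> w ** x = x ** w"
    and P: "det P \<noteq> 0" "conj_by P x = D"
    and D: "\<And>w. trace w = 0 \<Longrightarrow> w ** D = D ** w \<Longrightarrow> w \<in> \<uu>2 l"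
  shows "classified \<uu>"
proof (rule classified_conj_by [OF P(1)], rule classified_if_subset)
  show "lie_subalgebra_sl3 (conj_by P ` \<uu>)" "dim (conj_by P ` \<uu>) = 2"
    using lie_subalgebra_conj_by P(1) \<uu> by simp_all
  show "w \<in> \<uu>2 l" if w: "w \<in> conj_by P ` \<uu>" for w
  proof (rule D)
    show "trace w = 0"
      using w \<uu>(1) P(1) by (auto simp: lie_subalgebra_sl3_def sl3_def trace_conj_by)
    show "w ** D = D ** w"
      using w P comm by (auto simp flip: conj_by_mult)
  qed
qed

lemma commutant_diagonal:
  assumes "trace w = 0" "w ** mat3_of a 0 0 0 b 0 0 0 c = mat3_of a 0 0 0 b 0 0 0 c ** w"
    and "a \<noteq> b" "a \<noteq> c" "b \<noteq> c"
  shows "w \<in> \<uu>2 U5"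
  using assms by (cases w) (auto simp: mem_\<uu>2_iff)

lemma commutant_block:
  assumes "trace w = 0" "w ** mat3_of a 1 0 0 a 0 0 0 (-2*a) = mat3_of a 1 0 0 a 0 0 0 (-2*a) ** w"
    and "a \<noteq> 0"
  shows "w \<in> \<uu>2 U2"
  using assms by (cases w) (auto simp: mem_\<uu>2_iff)

lemma commutant_nilpotent:
  assumes "trace w = 0" "w ** mat3_of 0 1 0 0 0 1 0 0 0 = mat3_of 0 1 0 0 0 1 0 0 0 ** w"
  shows "w \<in> \<uu>2 U1"
  using assms by (cases w) (auto simp: mem_\<uu>2_iff)

lemma commutant_complex:
  assumes "trace w = 0" "w ** mat3_of p 0 \<omega> 0 (-2*p) 0 (-\<omega>) 0 p = mat3_of p 0 \<omega> 0 (-2*p) 0 (-\<omega>) 0 p ** w"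
    and "\<omega> \<noteq> 0"
  shows "w \<in> \<uu>2 U6"
proof (cases w)
  case (1 a b c d e f g h i)
  \<comment> \<open>This is the squared modulus of the difference between the eigenvalues
    \<open>p + i \<omega>\<close> and \<open>- 2 p\<close>. Being nonzero, it decouples the middle
    row and column from the complex block.\<close>
  have nz: "9 * p\<^sup>2 + \<omega>\<^sup>2 \<noteq> 0"
    using assms(3) by (simp add: add_nonneg_eq_0_iff)
  have "3 * p * b = - \<omega> * h" "3 * p * h = \<omega> * b" "3 * p * d = \<omega> * f" "3 * p * f = - \<omega> * d"
    "\<omega> * (a - i) = 0" "\<omega> * (c + g) = 0"
    using assms(2) by (auto simp: 1 algebra_simps)
  moreover from this have "(9 * p\<^sup>2 + \<omega>\<^sup>2) * b = 0" "(9 * p\<^sup>2 + \<omega>\<^sup>2) * h = 0"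
    "(9 * p\<^sup>2 + \<omega>\<^sup>2) * d = 0" "(9 * p\<^sup>2 + \<omega>\<^sup>2) * f = 0"
    by algebra+
  ultimately have "b = 0" "h = 0" "d = 0" "f = 0" "a = i" "g = - c"
    using assms(3) nz by auto
  then show ?thesis
    using assms(1) by (auto simp: 1 mem_\<uu>2_iff)
qed

text \<open>Root patterns of \<open>t ^ 3 + c * t + d\<close>: three distinct real roots lead to U5,
  a nonzero double root to U2, the triple root 0 to U1, a non-real pair to U6.\<close>

lemma classified_abelian_companion:
  assumes \<uu>: "lie_subalgebra_sl3 \<uu>" "dim \<uu> = 2"
    and comm: "\<And>w. w \<in> \<uu> \<Longrightarrow> w ** x = x ** w"
    and P: "det P \<noteq> 0" "conj_by P x = companion c d"
  shows "classified \<uu>"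
proof -
  have fin: "classified \<uu>" if "det Q \<noteq> 0" "conj_by Q (companion c d) = D"
    "\<And>w. trace w = 0 \<Longrightarrow> w ** D = D ** w \<Longrightarrow> w \<in> \<uu>2 l" for Q D l
  proof (rule classified_commutant [OF \<uu> comm])
    show "det (P ** Q) \<noteq> 0" "conj_by (P ** Q) x = D"
      using that P by (simp_all add: det_mul flip: conj_by_conj_by)
  qed (use that in auto)
  \<comment> \<open>The roots are \<open>a\<close>, \<open>a\<close>, \<open>- 2 a\<close>; for
    \<open>a = 0\<close> they collapse to a triple root.\<close>
  have double: "classified \<uu>" if cd: "c = - 3 * a\<^sup>2" "d = 2 * a ^ 3" for a
  proof (cases "a = 0")
    case True
    obtain Q where "det Q \<noteq> 0" "conj_by Q (companion 0 0) = mat3_of 0 1 0 0 0 1 0 0 0"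
      using conj_companion_0 by blast
    then show ?thesis
      using fin [of Q "mat3_of 0 1 0 0 0 1 0 0 0" U1] commutant_nilpotent cd True by simp
  next
    case False
    \<comment> \<open>Polynomials in the companion matrix correspond to their coefficient vectors; the columns of \<open>Q\<close>
      are \<open>(t - a) (t + 2a)\<close>, \<open>t + 2a\<close> and \<open>(t - a)\<^sup>2\<close>.\<close>
    define Q where "Q = mat3_of (- 2 * a\<^sup>2) (2 * a) (a\<^sup>2) a 1 (- 2 * a) 1 0 1"
    have "det Q = - 9 * a\<^sup>2"
      unfolding Q_def mat3_of_det by algebra
    then have Q: "det Q \<noteq> 0"
      using False by simp
    show ?thesis
    proof (rule fin [OF Q])
      show "conj_by Q (companion c d) = mat3_of a 1 0 0 a 0 0 0 (-2*a)"
        using Q by (simp add: conj_by_eq_iff) (simp add: Q_def companion_def cd power2_eq_square power3_eq_cube)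
    qed (use commutant_block False in blast)
  qed
  obtain r where r: "r ^ 3 + c * r + d = 0"
    using depressed_cubic_root by blast
  \<comment> \<open>the discriminant of the quadratic cofactor \<open>t\<^sup>2 + r t + r\<^sup>2 + c\<close>\<close>
  define D where "D = - 3 * r\<^sup>2 - 4 * c"
  show ?thesis
  proof (cases "D < 0")
    case True
    \<comment> \<open>The non-real roots are \<open>p + i \<omega>\<close> and
      \<open>p - i \<omega>\<close>.\<close>
    define p \<omega> where "p = - r / 2" and "\<omega> = sqrt (- D) / 2"
    have "\<omega> \<noteq> 0" "4 * \<omega>\<^sup>2 = - D" "r = - 2 * p"
      using True by (simp_all add: \<omega>_def p_def power_divide)
    then have c: "c = \<omega>\<^sup>2 - 3 * p\<^sup>2" and d: "d = 2 * p * (p\<^sup>2 + \<omega>\<^sup>2)"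
      using r unfolding D_def by algebra+
    \<comment> \<open>columns \<open>\<omega> (t + 2p)\<close>, \<open>(t - p)\<^sup>2 + \<omega>\<^sup>2\<close> and \<open>(p - t) (t + 2p)\<close>\<close>
    define Q where "Q = mat3_of (2 * p * \<omega>) (p\<^sup>2 + \<omega>\<^sup>2) (2 * p\<^sup>2) \<omega> (- 2 * p) (- p) 0 1 (- 1)"
    have "det Q = \<omega> * (9 * p\<^sup>2 + \<omega>\<^sup>2)"
      unfolding Q_def mat3_of_det by algebra
    then have Q: "det Q \<noteq> 0"
      using \<open>\<omega> \<noteq> 0\<close> by (simp add: add_nonneg_eq_0_iff)
    show ?thesis
    proof (rule fin [OF Q])
      show "conj_by Q (companion c d) = mat3_of p 0 \<omega> 0 (-2*p) 0 (-\<omega>) 0 p"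
        using Q by (simp add: conj_by_eq_iff) (simp add: Q_def companion_def c d power2_eq_square algebra_simps)
    qed (use commutant_complex \<open>\<omega> \<noteq> 0\<close> in blast)
  next
    case False
    \<comment> \<open>The roots are \<open>a\<close>, \<open>b\<close> and \<open>- a - b\<close>;
      \<open>b\<close> comes from the quadratic formula for the cofactor.\<close>
    define a b where "a = r" and "b = (sqrt D - r) / 2"
    have b: "(2 * b + r)\<^sup>2 = D"
      using False by (simp add: b_def field_simps)
    have c: "c = - (a\<^sup>2 + a * b + b\<^sup>2)"
      using b unfolding D_def a_def by algebra
    then have d: "d = a * b * (a + b)"
      using r unfolding a_def by algebra
    \<comment> \<open>The first three cases are the coincidences among the roots \<open>a\<close>,
      \<open>b\<close>, \<open>- a - b\<close>. The repeated root becomes the argument of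
      \<open>double\<close>.\<close>
    consider "a = b" | "2 * a + b = 0" | "a + 2 * b = 0" | "a \<noteq> b" "2 * a + b \<noteq> 0" "a + 2 * b \<noteq> 0"
      by blast
    then show ?thesis
    proof cases
      case 1
      then show ?thesis
        by (intro double [of a]) (simp_all add: c d power2_eq_square power3_eq_cube)
    next
      case 2
      then have "b = - 2 * a"
        by simp
      then show ?thesis
        by (intro double [of a]) (simp_all add: c d power2_eq_square power3_eq_cube)
    next
      case 3
      then have "a = - 2 * b"
        by simp
      then show ?thesis
        by (intro double [of b]) (simp_all add: c d power2_eq_square power3_eq_cube)
    next
      case 4
      define e where "e = - a - b"
      \<comment> \<open>columns \<open>(t - b) (t - e)\<close>, \<open>(t - a) (t - e)\<close> and \<open>(t - a) (t - b)\<close>\<close>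
      define Q where "Q = mat3_of (b * e) (a * e) (a * b) a b e 1 1 1"
      have "det Q = (a - b) * (2 * a + b) * (a + 2 * b)"
        unfolding Q_def mat3_of_det e_def by algebra
      then have Q: "det Q \<noteq> 0"
        using 4 by simp
      have ne: "a \<noteq> e" "b \<noteq> e"
        using 4 by (auto simp: e_def)
      show ?thesis
      proof (rule fin [OF Q])
        show "conj_by Q (companion c d) = mat3_of a 0 0 0 b 0 0 0 e"
          using Q by (simp add: conj_by_eq_iff)
            (simp add: Q_def companion_def c d e_def power2_eq_square algebra_simps)
      qed (use commutant_diagonal 4(1) ne in blast)
    qed
  qed
qed

section \<open>Abelian subalgebras without elements having a cyclic vector\<close>

lemma quadratic_commuting_pair:
  fixes x y :: mat3
  assumes comm: "x ** y = y ** x"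
    and x: "x ** x = (2 * a\<^sup>2) *\<^sub>R mat 1 - a *\<^sub>R x" and y: "y ** y = (2 * b\<^sup>2) *\<^sub>R mat 1 - b *\<^sub>R y"
    and plus: "(x + y) ** (x + y) = (2 * c\<^sup>2) *\<^sub>R mat 1 - c *\<^sub>R (x + y)"
    and minus: "(x - y) ** (x - y) = (2 * d\<^sup>2) *\<^sub>R mat 1 - d *\<^sub>R (x - y)"
    and ind: "\<And>k p q. k *\<^sub>R mat 1 + p *\<^sub>R x + q *\<^sub>R y = 0 \<Longrightarrow> p = 0 \<and> q = 0"
  shows "a = 0" "b = 0" "x ** y = 0"
proof -
  define I :: "3 \<Rightarrow> 3 \<Rightarrow> real" where "I i j = mat 1 $ i $ j" for i j
  have X: "(x ** x) $ i $ j = 2 * a\<^sup>2 * I i j - a * x $ i $ j"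
    and Y: "(y ** y) $ i $ j = 2 * b\<^sup>2 * I i j - b * y $ i $ j" for i j
    by (simp_all add: x y I_def)
  have P: "(x ** x) $ i $ j + 2 * (x ** y) $ i $ j + (y ** y) $ i $ j =
      2 * c\<^sup>2 * I i j - c * x $ i $ j - c * y $ i $ j" for i j
    using arg_cong [OF plus, of "\<lambda>A. A $ i $ j"]
    by (simp add: matrix_add_ldistrib matrix_mult_add_rdistrib comm I_def algebra_simps)
  have M: "(x ** x) $ i $ j - 2 * (x ** y) $ i $ j + (y ** y) $ i $ j =
      2 * d\<^sup>2 * I i j - d * x $ i $ j + d * y $ i $ j" for i j
    using arg_cong [OF minus, of "\<lambda>A. A $ i $ j"] by (simp add: matrix_mult_diff_distrib comm I_def algebra_simps)
  have ind': "p = 0 \<and> q = 0" if "\<And>i j. k * I i j + p * x $ i $ j + q * y $ i $ j = 0" for k p q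
    by (rule ind [of k]) (use that in \<open>simp add: mat3_eq_iff I_def\<close>)
  \<comment> \<open>Adding the identities for \<open>x + y\<close> and \<open>x - y\<close> cancels
    \<open>x ** y\<close> and leaves a linear relation among \<open>mat 1\<close>, \<open>x\<close>
    and \<open>y\<close>.\<close>
  have "c + d - 2 * a = 0 \<and> c - d - 2 * b = 0"
  proof (rule ind' [of "4 * a\<^sup>2 + 4 * b\<^sup>2 - 2 * c\<^sup>2 - 2 * d\<^sup>2"])
    show "(4 * a\<^sup>2 + 4 * b\<^sup>2 - 2 * c\<^sup>2 - 2 * d\<^sup>2) * I i j + (c + d - 2 * a) * x $ i $ j
        + (c - d - 2 * b) * y $ i $ j = 0" for i j
      using P [of i j] M [of i j] X [of i j] Y [of i j] by algebra
  qed
  then have c: "c = a + b" and d: "d = a - b"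
    by auto
  have xy_ij: "2 * (x ** y) $ i $ j = 4 * a * b * I i j - b * x $ i $ j - a * y $ i $ j" for i j
    using P [of i j] X [of i j] Y [of i j] unfolding c by algebra
  have xy: "2 *\<^sub>R (x ** y) = (4 * a * b) *\<^sub>R mat 1 - b *\<^sub>R x - a *\<^sub>R y"
    by (simp add: mat3_eq_iff xy_ij I_def)
  \<comment> \<open>Two evaluations of \<open>x ** x ** y\<close>, through \<open>x ** y\<close> and
    through \<open>x ** x\<close>. Their comparison is again linear in \<open>x\<close> and
    \<open>y\<close>, with vanishing scalar part.\<close>
  have xxy: "2 * (x ** x ** y) $ i $ j = 4 * a * b * x $ i $ j - b * (x ** x) $ i $ j - a * (x ** y) $ i $ j"
    "(x ** x ** y) $ i $ j = 2 * a\<^sup>2 * y $ i $ j - a * (x ** y) $ i $ j" for i j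
    using arg_cong [OF xy, of "\<lambda>A. (x ** A) $ i $ j"] arg_cong [OF x, of "\<lambda>A. (A ** y) $ i $ j"]
    by (simp_all add: matrix_mult_diff_distrib matrix_scaleR_mult matrix_mul_assoc)
  have "- 9 * a * b = 0 \<and> 9 * a\<^sup>2 = 0"
  proof (rule ind' [of 0])
    show "0 * I i j + - 9 * a * b * x $ i $ j + 9 * a\<^sup>2 * y $ i $ j = 0" for i j
      using xxy [of i j] xy_ij [of i j] X [of i j] by algebra
  qed
  then show a: "a = 0"
    by simp
  \<comment> \<open>The same comparison for \<open>x ** y ** y\<close>, now with
    \<open>a = 0\<close>.\<close>
  have xyy: "2 * (x ** y ** y) $ i $ j = - b * (x ** y) $ i $ j"
    "(x ** y ** y) $ i $ j = 2 * b\<^sup>2 * x $ i $ j - b * (x ** y) $ i $ j" for i j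
    using arg_cong [OF xy, of "\<lambda>A. (A ** y) $ i $ j"] arg_cong [OF y, of "\<lambda>A. (x ** A) $ i $ j"]
    by (simp_all add: a matrix_mult_diff_distrib matrix_scaleR_mult matrix_mul_assoc)
  have "9 * b\<^sup>2 = 0 \<and> 0 = (0 :: real)"
  proof (rule ind' [of 0])
    show "0 * I i j + 9 * b\<^sup>2 * x $ i $ j + 0 * y $ i $ j = 0" for i j
      using xyy [of i j] xy_ij [of i j] a by algebra
  qed
  then show b: "b = 0"
    by simp
  show "x ** y = 0"
    using xy a b by simp
qed

lemma obtain_two_dim_basis:
  assumes "subspace \<uu>" "dim \<uu> = 2"
  obtains x y :: "'a :: euclidean_space"
  where "x \<in> \<uu>" "y \<in> \<uu>" "x \<noteq> 0" "\<And>c. y \<noteq> c *\<^sub>R x"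
proof -
  obtain B where B: "B \<subseteq> \<uu>" "independent B" "card B = 2"
    using basis_exists [of \<uu>] assms(2) by metis
  then obtain x y where xy: "B = {x, y}" "x \<noteq> y"
    by (meson card_2_iff)
  have "independent (insert y {x})"
    using B(2) xy by (simp add: insert_commute)
  then have "x \<noteq> 0" "y \<notin> span {x}"
    using xy(2) by (simp_all add: independent_insert split: if_splits)
  then show thesis
    using that [of x y] B(1) xy by (auto simp: span_breakdown_eq)
qed

text \<open>Annihilating \<open>X\<alpha>\<close> from both sides clears the first column and second
  row of \<open>Y\<close>, and the trace its last diagonal entry. \<open>Y ** Y = 0\<close> then
  makes the (1,3) or the (3,2) entry vanish, which gives U4 or U3.\<close>

lemma classified_square_zero:
  assumes \<uu>: "lie_subalgebra_sl3 \<uu>" "dim \<uu> = 2"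
    and xy: "x \<in> \<uu>" "y \<in> \<uu>" "x \<noteq> 0" "\<And>c. y \<noteq> c *\<^sub>R x"
    and sq: "x ** x = 0" "y ** y = 0" "x ** y = 0" "y ** x = 0"
  shows "classified \<uu>"
proof -
  obtain P where P: "det P \<noteq> 0" "conj_by P x = X\<alpha>"
    using square_zero_conj sq(1) xy(3) by blast
  define Y where "Y = conj_by P y"
  have "trace y = 0"
    using \<uu>(1) xy(2) by (auto simp: lie_subalgebra_sl3_def sl3_def)
  then have Y: "trace Y = 0" "Y ** Y = 0" "X\<alpha> ** Y = 0" "Y ** X\<alpha> = 0"
    using P(1) sq by (simp_all add: Y_def trace_conj_by conj_by_hom(5) flip: P(2) conj_by_mult)
  have "X\<alpha> \<in> \<uu>2 U3" "X\<alpha> \<in> \<uu>2 U4"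
    by (simp_all add: \<uu>2.simps span_base)
  moreover have "Y \<in> \<uu>2 U3 \<or> Y \<in> \<uu>2 U4"
    using Y by (cases Y) (auto simp: basis_mat3_of zero_mat3_of mem_\<uu>2_iff)
  ultimately obtain l where "X\<alpha> \<in> \<uu>2 l" "Y \<in> \<uu>2 l"
    by blast
  then show ?thesis
    using classified_pair [OF \<uu> xy P(1)] P(2) Y_def by simp
qed

lemma classified_abelian:
  assumes \<uu>: "lie_subalgebra_sl3 \<uu>" "dim \<uu> = 2"
    and comm: "\<And>x y. x \<in> \<uu> \<Longrightarrow> y \<in> \<uu> \<Longrightarrow> x ** y = y ** x"
  shows "classified \<uu>"
proof (cases "\<exists>x\<in>\<uu>. \<exists>P c d. det P \<noteq> 0 \<and> conj_by P x = companion c d")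
  case True
  then show ?thesis
    using classified_abelian_companion [OF \<uu> comm] by blast
next
  case False
  have tr: "trace x = 0" if "x \<in> \<uu>" for x
    using that \<uu>(1) by (auto simp: lie_subalgebra_sl3_def sl3_def)
  have sub: "subspace \<uu>"
    using \<uu>(1) by (simp add: lie_subalgebra_sl3_def)
  have quad: "\<exists>a. x ** x = (2 * a\<^sup>2) *\<^sub>R mat 1 - a *\<^sub>R x" if "x \<in> \<uu>" for x
    using companion_or_quadratic [OF tr [OF that]] False that by metis
  obtain x y where xy: "x \<in> \<uu>" "y \<in> \<uu>" "x \<noteq> 0" "\<And>c. y \<noteq> c *\<^sub>R x"
    using obtain_two_dim_basis [OF sub \<uu>(2)] by blast
  obtain a b where a: "x ** x = (2 * a\<^sup>2) *\<^sub>R mat 1 - a *\<^sub>R x"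
    and b: "y ** y = (2 * b\<^sup>2) *\<^sub>R mat 1 - b *\<^sub>R y"
    using quad xy by meson
  obtain c d where c: "(x + y) ** (x + y) = (2 * c\<^sup>2) *\<^sub>R mat 1 - c *\<^sub>R (x + y)"
    and d: "(x - y) ** (x - y) = (2 * d\<^sup>2) *\<^sub>R mat 1 - d *\<^sub>R (x - y)"
    using quad subspace_add [OF sub xy(1,2)] subspace_diff [OF sub xy(1,2)] by meson
  \<comment> \<open>As \<open>x\<close> and \<open>y\<close> are traceless, taking traces first
    removes the identity from the relation.\<close>
  have ind: "p = 0 \<and> q = 0" if eq: "k *\<^sub>R mat 1 + p *\<^sub>R x + q *\<^sub>R y = 0" for k p q
  proof -
    have "trace (k *\<^sub>R (mat 1 :: mat3) + p *\<^sub>R x + q *\<^sub>R y) = 3 * k"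
      using tr xy by (simp add: trace_add trace_scaleR one_mat3_of)
    then have "k = 0"
      using eq by (simp add: zero_mat3_of)
    then have pq: "p *\<^sub>R x + q *\<^sub>R y = 0"
      using eq by simp
    have "q = 0"
    proof (rule ccontr)
      assume "q \<noteq> 0"
      moreover have "q *\<^sub>R y = - p *\<^sub>R x"
        using pq by (simp add: eq_neg_iff_add_eq_0 add.commute)
      ultimately have "y = (- p / q) *\<^sub>R x"
        by (metis (no_types, lifting) divide_inverse_commute scaleR_scaleR scaleR_one left_inverse)
      then show False
        using xy(4) by blast
    qed
    then show ?thesis
      using pq xy(3) by simp
  qed
  note quadratic_commuting_pair [OF comm [OF xy(1,2)] a b c d ind]
  then show ?thesis
    using classified_square_zero [OF \<uu> xy] a b comm [OF xy(1,2)] by simp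
qed

lemma classified_two_dim:
  assumes "lie_subalgebra_sl3 \<uu>" "dim \<uu> = 2"
  shows "classified \<uu>"
  using classified_abelian [OF assms] classified_nonabelian [OF assms] by blast

section \<open>Conjugation invariants of the list\<close>

lemma lie_subalgebra_span_pair:
  assumes "trace A = 0" "trace B = 0" "A ** B - B ** A = c *\<^sub>R A"
  shows "lie_subalgebra_sl3 (span {A, B})"
proof -
  have "bracket (p *\<^sub>R A + q *\<^sub>R B) (p' *\<^sub>R A + q' *\<^sub>R B) = (p * q' - q * p') *\<^sub>R (A ** B - B ** A)"
    for p q p' q'
    by (simp add: bracket_def matrix_add_ldistrib matrix_mult_add_rdistrib matrix_scaleR_mult
        algebra_simps)
  then have "bracket (p *\<^sub>R A + q *\<^sub>R B) (p' *\<^sub>R A + q' *\<^sub>R B) \<in> span {A, B}" for p q p' q'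
    by (simp add: assms(3) span_base span_mul)
  then show ?thesis
    using assms(1,2)
    by (auto simp: lie_subalgebra_sl3_def sl3_def span_pair_iff [of _ A B] trace_add trace_scaleR)
qed

lemma lie_subalgebra_\<uu>2: "lie_subalgebra_sl3 (\<uu>2 l)"
proof -
  have *: "lie_subalgebra_sl3 (span {A, B})"
    if "trace A = 0" "trace B = 0" "\<exists>c. A ** B - B ** A = c *\<^sub>R A" for A B
    using lie_subalgebra_span_pair that by blast
  show ?thesis
    by (cases l; simp only: \<uu>2.simps; rule *) (auto simp: basis_mat3_of zero_mat3_of)
qed

lemma dim_span_pair:
  assumes "\<And>p q. p *\<^sub>R A + q *\<^sub>R B = 0 \<Longrightarrow> p = 0 \<and> q = 0"
  shows "dim (span {A, B :: 'a :: euclidean_space}) = 2"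
proof -
  have "A \<noteq> 0"
    using assms [of 1 0] by auto
  moreover have "B \<notin> span {A}"
    using assms [of _ "- 1"] by (auto simp: span_breakdown_eq)
  ultimately have "independent {B, A}" "B \<noteq> A"
    by (auto simp: independent_insert span_base)
  then show ?thesis
    by (simp add: dim_eq_card_independent insert_commute)
qed

lemma dim_\<uu>2: "dim (\<uu>2 l) = 2"
  by (cases l; simp only: \<uu>2.simps; rule dim_span_pair)
    (auto simp: basis_mat3_of zero_mat3_of)

section \<open>Properties preserved by conjugation\<close>

lemma SL3_conjugate_sym:
  assumes "\<uu> \<sim>\<^sub>S\<^sub>L \<vv>"
  shows "\<vv> \<sim>\<^sub>S\<^sub>L \<uu>"
proof -
  obtain P where P: "det P \<noteq> 0" "\<vv> = conj_by P ` \<uu>"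
    using assms by (auto simp: SL3_conjugate_iff)
  have PQ: "P ** matrix_inv P = mat 1"
    using P by (simp add: matrix_inv_mult)
  then have Q: "det (matrix_inv P) \<noteq> 0"
    by (metis det_I det_mul mult_zero_right zero_neq_one)
  then have "conj_by (matrix_inv P) (conj_by P x) = x" for x
    using P(1) PQ by (simp add: conj_by_conj_by conj_by_eq_iff)
  then have "\<uu> = conj_by (matrix_inv P) ` \<vv>"
    using P(2) by (simp add: image_image)
  then show ?thesis
    using Q by (auto simp: SL3_conjugate_iff)
qed

text \<open>Preservation in one direction is enough, since conjugacy is symmetric.\<close>

definition conj_invariant :: "(mat3 set \<Rightarrow> bool) \<Rightarrow> bool" where
  "conj_invariant \<Phi> \<longleftrightarrow> (\<forall>P \<uu>. det P \<noteq> 0 \<longrightarrow> \<Phi> \<uu> \<longrightarrow> \<Phi> (conj_by P ` \<uu>))"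

lemma conj_invariantD:
  assumes "conj_invariant \<Phi>" "\<uu> \<sim>\<^sub>S\<^sub>L \<vv>"
  shows "\<Phi> \<uu> \<longleftrightarrow> \<Phi> \<vv>"
  using assms SL3_conjugate_sym unfolding conj_invariant_def SL3_conjugate_iff by metis

definition "abelian \<uu> \<longleftrightarrow> (\<forall>x\<in>\<uu>. \<forall>y\<in>\<uu>. x ** y = y ** (x :: mat3))"
definition "square_null \<uu> \<longleftrightarrow> (\<forall>x\<in>\<uu>. x ** x = (0 :: mat3))"
definition "cube_null \<uu> \<longleftrightarrow> (\<forall>x\<in>\<uu>. x ** x ** x = (0 :: mat3))"
definition "has_square_null \<uu> \<longleftrightarrow> (\<exists>x\<in>\<uu>. x \<noteq> 0 \<and> x ** x = (0 :: mat3))"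
text \<open>Detects a non-real eigenvalue: if all eigenvalues are real, the trace of the square is a
  sum of squares.\<close>

definition "has_neg_trace \<uu> \<longleftrightarrow> (\<exists>x\<in>\<uu>. trace (x ** (x :: mat3)) < 0)"
text \<open>An idempotent of trace 1 projects onto a line, so the images of all elements lie in one
  line.\<close>

definition "common_image \<uu> \<longleftrightarrow> (\<exists>e :: mat3. e ** e = e \<and> trace e = 1 \<and> (\<forall>x\<in>\<uu>. e ** x = x))"
text \<open>The last equation says that \<open>h\<close> acts on the image of \<open>z\<close> as
  the scalar \<open>a\<close>, which expresses the parameter of U10 without reference to a
  basis.\<close>

definition "ad_eigen \<uu> a h z \<longleftrightarrow> h \<in> \<uu> \<and> z \<in> \<uu> \<and> z \<noteq> 0 \<and> z ** z = 0 \<and> h ** z - z ** h = - z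
  \<and> h ** z = a *\<^sub>R (z :: mat3)"
definition "weight a \<uu> \<longleftrightarrow> (\<exists>h z. ad_eigen \<uu> a h z)"
text \<open>The extra equation makes \<open>h\<close> diagonalizable with eigenvalues among
  \<open>a\<close> and \<open>a + 1\<close>.\<close>

definition "ss_weight a \<uu> \<longleftrightarrow>
  (\<exists>h z. ad_eigen \<uu> a h z \<and> (h - a *\<^sub>R mat 1) ** (h - (a + 1) *\<^sub>R mat 1) = 0)"

lemma conj_by_eq_0_iff: "det P \<noteq> 0 \<Longrightarrow> conj_by P x = 0 \<longleftrightarrow> x = 0"
  using conj_by_inject [of P x 0] by (simp add: conj_by_hom)

lemma ad_eigen_conj_by:
  assumes "det P \<noteq> 0" "ad_eigen \<uu> a h z"
  shows "ad_eigen (conj_by P ` \<uu>) a (conj_by P h) (conj_by P z)"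
  using assms by (auto simp: ad_eigen_def conj_by_eq_0_iff simp flip: conj_by_mult conj_by_hom(2-4))

lemma conj_invariants:
  "conj_invariant abelian" "conj_invariant square_null" "conj_invariant cube_null"
  "conj_invariant has_square_null" "conj_invariant has_neg_trace" "conj_invariant common_image"
  "conj_invariant (weight a)" "conj_invariant (ss_weight a)"
proof -
  show "conj_invariant abelian" "conj_invariant square_null" "conj_invariant cube_null"
    "conj_invariant has_square_null" "conj_invariant has_neg_trace"
    unfolding conj_invariant_def abelian_def square_null_def cube_null_def has_square_null_def
      has_neg_trace_def
    by (auto simp: trace_conj_by conj_by_eq_0_iff simp flip: conj_by_mult)
  show "conj_invariant common_image"
    unfolding conj_invariant_def common_image_def
  proof (intro allI impI, elim exE conjE)
    fix P e :: mat3 and \<uu> :: "mat3 set"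
    assume "det P \<noteq> 0" "e ** e = e" "trace e = 1" "\<forall>x\<in>\<uu>. e ** x = x"
    then show "\<exists>e. e ** e = e \<and> trace e = 1 \<and> (\<forall>x\<in>conj_by P ` \<uu>. e ** x = x)"
      by (intro exI [of _ "conj_by P e"]) (simp add: trace_conj_by flip: conj_by_mult)
  qed
  show "conj_invariant (weight a)"
    unfolding conj_invariant_def weight_def using ad_eigen_conj_by by blast
  show "conj_invariant (ss_weight a)"
    unfolding conj_invariant_def ss_weight_def
  proof (intro allI impI, elim exE conjE)
    fix P h z :: mat3 and \<uu> :: "mat3 set"
    assume P: "det P \<noteq> 0" and "ad_eigen \<uu> a h z"
      and ss: "(h - a *\<^sub>R mat 1) ** (h - (a + 1) *\<^sub>R mat 1) = 0"
    moreover have "(conj_by P h - a *\<^sub>R mat 1) ** (conj_by P h - (a + 1) *\<^sub>R mat 1) = 0"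
      using arg_cong [OF ss, of "conj_by P"] P
      by (simp add: conj_by_mult conj_by_hom conj_by_one)
    ultimately show "\<exists>h z. ad_eigen (conj_by P ` \<uu>) a h z \<and>
        (h - a *\<^sub>R mat 1) ** (h - (a + 1) *\<^sub>R mat 1) = 0"
      using ad_eigen_conj_by by blast
  qed
qed

section \<open>Values of the invariants on the entries\<close>

lemma span_pair_values:
  assumes "\<uu> = span {A, B :: mat3}"
  shows "A ** B \<noteq> B ** A \<Longrightarrow> \<not> abelian \<uu>"
    "A ** A \<noteq> 0 \<or> B ** B \<noteq> 0 \<Longrightarrow> \<not> square_null \<uu>"
    "A ** A ** A \<noteq> 0 \<or> B ** B ** B \<noteq> 0 \<Longrightarrow> \<not> cube_null \<uu>"
    "A \<noteq> 0 \<and> A ** A = 0 \<or> B \<noteq> 0 \<and> B ** B = 0 \<Longrightarrow> has_square_null \<uu>"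
    "trace (A ** A) < 0 \<or> trace (B ** B) < 0 \<Longrightarrow> has_neg_trace \<uu>"
proof -
  have "A \<in> \<uu>" "B \<in> \<uu>"
    by (simp_all add: assms span_base)
  then show "A ** B \<noteq> B ** A \<Longrightarrow> \<not> abelian \<uu>"
    "A ** A \<noteq> 0 \<or> B ** B \<noteq> 0 \<Longrightarrow> \<not> square_null \<uu>"
    "A ** A ** A \<noteq> 0 \<or> B ** B ** B \<noteq> 0 \<Longrightarrow> \<not> cube_null \<uu>"
    "A \<noteq> 0 \<and> A ** A = 0 \<or> B \<noteq> 0 \<and> B ** B = 0 \<Longrightarrow> has_square_null \<uu>"
    "trace (A ** A) < 0 \<or> trace (B ** B) < 0 \<Longrightarrow> has_neg_trace \<uu>"
    unfolding abelian_def square_null_def cube_null_def has_square_null_def has_neg_trace_def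
    by blast+
qed

lemma abelian_\<uu>2: "abelian (\<uu>2 l) \<longleftrightarrow> l \<in> {U1, U2, U3, U4, U5, U6}"
proof
  show "abelian (\<uu>2 l)" if "l \<in> {U1, U2, U3, U4, U5, U6}"
    using that by (auto simp: abelian_def mem_\<uu>2_iff)
  have "\<not> abelian (\<uu>2 U7)" "\<not> abelian (\<uu>2 U8)" "\<not> abelian (\<uu>2 U9)" "\<not> abelian (\<uu>2 (U10 a))" for a
    by (rule span_pair_values(1) [OF \<uu>2.simps(7)] span_pair_values(1) [OF \<uu>2.simps(8)]
        span_pair_values(1) [OF \<uu>2.simps(9)] span_pair_values(1) [OF \<uu>2.simps(10)],
        simp add: basis_mat3_of)+
  then show "l \<in> {U1, U2, U3, U4, U5, U6}" if "abelian (\<uu>2 l)"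
    using that by (cases l) auto
qed

lemma square_null_\<uu>2:
  "square_null (\<uu>2 U3)" "square_null (\<uu>2 U4)"
  "\<not> square_null (\<uu>2 U1)" "\<not> square_null (\<uu>2 U2)"
  "\<not> square_null (\<uu>2 U5)" "\<not> square_null (\<uu>2 U6)"
proof -
  show "square_null (\<uu>2 U3)" "square_null (\<uu>2 U4)"
    by (auto simp: square_null_def mem_\<uu>2_iff zero_mat3_of)
qed (rule span_pair_values(2) [OF \<uu>2.simps(1)] span_pair_values(2) [OF \<uu>2.simps(2)]
    span_pair_values(2) [OF \<uu>2.simps(5)] span_pair_values(2) [OF \<uu>2.simps(6)],
    simp add: basis_mat3_of zero_mat3_of)+

lemma cube_null_\<uu>2: "cube_null (\<uu>2 U1)" "\<not> cube_null (\<uu>2 U2)"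
proof -
  show "cube_null (\<uu>2 U1)"
    by (auto simp: cube_null_def mem_\<uu>2_iff zero_mat3_of)
qed (rule span_pair_values(3) [OF \<uu>2.simps(2)], simp add: basis_mat3_of zero_mat3_of)

lemma common_image_\<uu>2: "common_image (\<uu>2 U3)" "\<not> common_image (\<uu>2 U4)"
proof -
  have "e ** x = x" if "e = mat3_of 1 0 0 0 0 0 0 0 0" "x \<in> \<uu>2 U3" for e x
    using that by (auto simp: mem_\<uu>2_iff)
  then show "common_image (\<uu>2 U3)"
    unfolding common_image_def by (intro exI [of _ "mat3_of 1 0 0 0 0 0 0 0 0"]) auto
  show "\<not> common_image (\<uu>2 U4)"
  proof
    assume "common_image (\<uu>2 U4)"
    then obtain e where e: "e ** e = e" "trace e = 1" "\<And>x. x \<in> \<uu>2 U4 \<Longrightarrow> e ** x = x"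
      unfolding common_image_def by blast
    have "X\<alpha> \<in> \<uu>2 U4" "Y\<beta> \<in> \<uu>2 U4"
      by (simp_all add: \<uu>2.simps span_base)
    then have "e ** X\<alpha> = X\<alpha>" "e ** Y\<beta> = Y\<beta>"
      using e(3) by blast+
    \<comment> \<open>\<open>e\<close> fixes the first and third unit vectors, so trace 1 forces the
      middle diagonal entry to be -1, whereas idempotence makes it 0 or 1.\<close>
    then show False
      using e(1,2) by (cases e) (auto simp: basis_mat3_of)
  qed
qed

lemma has_square_null_\<uu>2:
  "has_square_null (\<uu>2 U1)" "has_square_null (\<uu>2 U2)"
  "\<not> has_square_null (\<uu>2 U5)" "\<not> has_square_null (\<uu>2 U6)"
proof -
  show "\<not> has_square_null (\<uu>2 U5)" "\<not> has_square_null (\<uu>2 U6)"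
    by (auto simp: has_square_null_def mem_\<uu>2_iff zero_mat3_of)
qed (rule span_pair_values(4) [OF \<uu>2.simps(1)] span_pair_values(4) [OF \<uu>2.simps(2)],
    simp add: basis_mat3_of zero_mat3_of)+

lemma has_neg_trace_\<uu>2: "has_neg_trace (\<uu>2 U6)" "\<not> has_neg_trace (\<uu>2 U5)"
proof -
  show "has_neg_trace (\<uu>2 U6)"
    by (rule span_pair_values(5) [OF \<uu>2.simps(6)]) (simp add: basis_mat3_of)
  show "\<not> has_neg_trace (\<uu>2 U5)"
    by (auto simp: has_neg_trace_def mem_\<uu>2_iff not_less)
qed

text \<open>U7 contains no nonzero element of square zero to serve as \<open>z\<close>.\<close>

lemma not_weight_\<uu>2_U7: "\<not> weight a (\<uu>2 U7)"
  by (auto simp: weight_def ad_eigen_def mem_\<uu>2_iff zero_mat3_of)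

text \<open>Comparing (1,2) entries, the commutator relation gives \<open>q = 1\<close> and the
  action on \<open>z\<close> gives \<open>a = b\<close>. The common factor \<open>q\<close> lets one
  shape cover U8, U9 and U10.\<close>

lemma ad_eigen_upper:
  assumes "ad_eigen \<uu> a (mat3_of (q * b) p r 0 (q * (b + 1)) 0 0 s t) (mat3_of 0 p' 0 0 0 0 0 0 0)"
  shows "q = 1 \<and> a = b"
proof -
  have "p' \<noteq> 0" "q * b * p' - p' * (q * (b + 1)) = - p'" "q * b * p' = a * p'"
    using assms by (auto simp: ad_eigen_def zero_mat3_of)
  moreover from this(2) have "p' * (q - 1) = 0"
    by algebra
  ultimately show ?thesis
    by auto
qed

lemma ad_eigen_\<uu>2:
  assumes "ad_eigen (\<uu>2 l) a h z"
  shows "l = U8 \<Longrightarrow> a = - 1/3 \<and> (\<exists>p. h = mat3_of (-1/3) p (-1) 0 (2/3) 0 0 0 (-1/3))"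
    and "l = U9 \<Longrightarrow> a = - 2/3 \<and> (\<exists>p. h = mat3_of (-2/3) p 0 0 (1/3) 0 0 1 (1/3))"
    and "l = U10 b \<Longrightarrow> a = b"
proof -
  have hz: "h \<in> \<uu>2 l" "z \<in> \<uu>2 l" "z ** z = 0"
    using assms by (auto simp: ad_eigen_def)
  show "a = - 1/3 \<and> (\<exists>p. h = mat3_of (-1/3) p (-1) 0 (2/3) 0 0 0 (-1/3))" if l: "l = U8"
  proof -
    obtain p q where h: "h = mat3_of (-q) p (-3*q) 0 (2*q) 0 0 0 (-q)"
      using hz(1) by (auto simp: l mem_\<uu>2_iff)
    obtain p' where z: "z = mat3_of 0 p' 0 0 0 0 0 0 0"
      using hz(2,3) by (auto simp: l mem_\<uu>2_iff zero_mat3_of)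
    show ?thesis
      using ad_eigen_upper [of "\<uu>2 l" a "3*q" "- 1/3" p "- 3*q" 0 "- q" p'] assms by (auto simp: h z)
  qed
  show "a = - 2/3 \<and> (\<exists>p. h = mat3_of (-2/3) p 0 0 (1/3) 0 0 1 (1/3))" if l: "l = U9"
  proof -
    obtain p q where h: "h = mat3_of (-2*q) p 0 0 q 0 0 (3*q) q"
      using hz(1) by (auto simp: l mem_\<uu>2_iff)
    obtain p' where z: "z = mat3_of 0 p' 0 0 0 0 0 0 0"
      using hz(2,3) by (auto simp: l mem_\<uu>2_iff zero_mat3_of)
    show ?thesis
      using ad_eigen_upper [of "\<uu>2 l" a "3*q" "- 2/3" p 0 "3*q" q p'] assms by (auto simp: h z)
  qed
  show "a = b" if l: "l = U10 b"
  proof -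
    obtain p q where h: "h = mat3_of (b*q) p 0 0 ((b+1)*q) 0 0 0 (-(2*b+1)*q)"
      using hz(1) by (auto simp: l mem_\<uu>2_iff)
    obtain p' q' where z: "z = mat3_of (b*q') p' 0 0 ((b+1)*q') 0 0 0 (-(2*b+1)*q')"
      using hz(2) by (auto simp: l mem_\<uu>2_iff)
    \<comment> \<open>The diagonal of \<open>z ** z\<close> contains the squares of
      \<open>b * q'\<close> and \<open>(b + 1) * q'\<close>, and \<open>b\<close> and
      \<open>b + 1\<close> are not both 0.\<close>
    have "q' = 0"
      using hz(3) by (auto simp: z zero_mat3_of)
    then show ?thesis
      using ad_eigen_upper [of "\<uu>2 l" a q b p 0 0 "-(2*b+1)*q" p'] assms
      by (auto simp: h z mult.commute)
  qed
qed

lemma weight_\<uu>2: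
  "weight a (\<uu>2 U8) \<longleftrightarrow> a = - 1/3" "weight a (\<uu>2 U9) \<longleftrightarrow> a = - 2/3" "weight a (\<uu>2 (U10 b)) \<longleftrightarrow> a = b"
proof -
  have weightI: "weight a (\<uu>2 l)" if "ad_eigen (\<uu>2 l) a h X\<alpha>" for l h
    using that by (auto simp: weight_def)
  have X: "X\<alpha> \<in> \<uu>2 U8" "X\<alpha> \<in> \<uu>2 U9" "X\<alpha> \<in> \<uu>2 (U10 a)"
    by (simp_all add: \<uu>2.simps span_base)
  have "weight a (\<uu>2 U8)" if "a = - 1/3"
    using X that by (intro weightI [of _ "mat3_of (-1/3) 0 (-1) 0 (2/3) 0 0 0 (-1/3)"])
      (auto simp: ad_eigen_def mem_\<uu>2_iff basis_mat3_of zero_mat3_of intro!: exI [of _ "1/3"])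
  moreover have "a = - 1/3" if "weight a (\<uu>2 U8)"
    using that ad_eigen_\<uu>2 unfolding weight_def by blast
  ultimately show "weight a (\<uu>2 U8) \<longleftrightarrow> a = - 1/3"
    by blast
  have "weight a (\<uu>2 U9)" if "a = - 2/3"
    using X that by (intro weightI [of _ "mat3_of (-2/3) 0 0 0 (1/3) 0 0 1 (1/3)"])
      (auto simp: ad_eigen_def mem_\<uu>2_iff basis_mat3_of zero_mat3_of intro!: exI [of _ "1/3"])
  moreover have "a = - 2/3" if "weight a (\<uu>2 U9)"
    using that ad_eigen_\<uu>2 unfolding weight_def by blast
  ultimately show "weight a (\<uu>2 U9) \<longleftrightarrow> a = - 2/3"
    by blast
  have "weight a (\<uu>2 (U10 a))"
    using X by (intro weightI [of _ "mat3_of a 0 0 0 (a + 1) 0 0 0 (- 2 * a - 1)"])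
      (auto simp: ad_eigen_def mem_\<uu>2_iff basis_mat3_of zero_mat3_of intro: exI [of _ 1])
  moreover have "a = b" if "weight a (\<uu>2 (U10 b))"
    using that ad_eigen_\<uu>2 unfolding weight_def by blast
  ultimately show "weight a (\<uu>2 (U10 b)) \<longleftrightarrow> a = b"
    by blast
qed

text \<open>In U8 and U9 the off-diagonal entry -1 or 1 joins two equal diagonal entries of
  \<open>h\<close>, so a Jordan block remains. At the matching parameters of U10 a diagonal
  \<open>h\<close> is available.\<close>

lemma ss_weight_\<uu>2:
  "\<not> ss_weight a (\<uu>2 U8)" "\<not> ss_weight a (\<uu>2 U9)"
  "ss_weight (- (1/3)) (\<uu>2 (U10 (- (1/3))))" "ss_weight (- (2/3)) (\<uu>2 (U10 (- (2/3))))"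
proof -
  have X: "X\<alpha> \<in> \<uu>2 (U10 a)" for a
    by (simp_all add: \<uu>2.simps span_base)
  have *: "ss_weight a (\<uu>2 l)"
    if "ad_eigen (\<uu>2 l) a h X\<alpha>" "(h - a *\<^sub>R mat 1) ** (h - (a + 1) *\<^sub>R mat 1) = 0" for l h a
    using that unfolding ss_weight_def by blast
  show "ss_weight (- (1/3)) (\<uu>2 (U10 (- (1/3))))"
    using X by (intro * [of _ _ "mat3_of (-1/3) 0 0 0 (2/3) 0 0 0 (-1/3)"])
      (auto simp: ad_eigen_def mem_\<uu>2_iff basis_mat3_of zero_mat3_of one_mat3_of)
  show "ss_weight (- (2/3)) (\<uu>2 (U10 (- (2/3))))"
    using X by (intro * [of _ _ "mat3_of (-2/3) 0 0 0 (1/3) 0 0 0 (1/3)"])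
      (auto simp: ad_eigen_def mem_\<uu>2_iff basis_mat3_of zero_mat3_of one_mat3_of)
  show "\<not> ss_weight a (\<uu>2 U8)" "\<not> ss_weight a (\<uu>2 U9)"
    by (auto simp: ss_weight_def one_mat3_of zero_mat3_of dest!: ad_eigen_\<uu>2(1) [OF _ refl] ad_eigen_\<uu>2(2) [OF _ refl])
qed

section \<open>Pairwise non-conjugacy and the full classification\<close>

lemma \<uu>2_not_conjugate:
  assumes "\<uu>2 l \<sim>\<^sub>S\<^sub>L \<uu>2 m"
  shows "l = m"
proof -
  note inv = conj_invariants [THEN conj_invariantD, OF assms]
  have ab: "l \<in> {U1, U2, U3, U4, U5, U6} \<longleftrightarrow> m \<in> {U1, U2, U3, U4, U5, U6}"
    using inv(1) by (simp only: abelian_\<uu>2)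
  show ?thesis
  proof (cases "l \<in> {U1, U2, U3, U4, U5, U6}")
    case True
    with ab have "m \<in> {U1, U2, U3, U4, U5, U6}"
      by simp
    with True inv(2-6) show ?thesis
      \<comment> \<open>\<open>square_null\<close> singles out U3 and U4, which
        \<open>common_image\<close> separates. Of the rest, \<open>has_square_null\<close> splits
        U1, U2 from U5, U6; \<open>cube_null\<close> separates the first pair and
        \<open>has_neg_trace\<close> the second.\<close>
      by (elim insertE emptyE; simp add: square_null_\<uu>2 cube_null_\<uu>2 has_square_null_\<uu>2 has_neg_trace_\<uu>2 common_image_\<uu>2)
  next
    case False
    with ab have m: "m \<notin> {U1, U2, U3, U4, U5, U6}"
      by simp
    have W: "weight a (\<uu>2 l) \<longleftrightarrow> weight a (\<uu>2 m)" and S: "ss_weight a (\<uu>2 l) \<longleftrightarrow> ss_weight a (\<uu>2 m)" for a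
      using inv(7,8) by blast+
    \<comment> \<open>A weight identifies a non-abelian entry except for the coincidences of U8 with
      \<open>U10 (- 1/3)\<close> and U9 with \<open>U10 (- 2/3)\<close>, which
      \<open>ss_weight\<close> resolves. U7 is the one non-abelian entry without a weight.\<close>
    have wt: "k = U8 \<and> a = - 1/3 \<or> k = U9 \<and> a = - 2/3 \<or> k = U10 a"
      if "weight a (\<uu>2 k)" "k \<notin> {U1, U2, U3, U4, U5, U6}" for a k
      using that by (cases k) (simp_all add: not_weight_\<uu>2_U7 weight_\<uu>2)
    show ?thesis
    proof (cases "\<exists>a. weight a (\<uu>2 l)")
      case True
      then obtain a where "weight a (\<uu>2 l)" "weight a (\<uu>2 m)"
        using W by blast
      from wt [OF this(1) False] wt [OF this(2) m] S ss_weight_\<uu>2 show ?thesis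
        by auto
    next
      case no_weight: False
      have "k = U7" if "\<not> (\<exists>a. weight a (\<uu>2 k))" "k \<notin> {U1, U2, U3, U4, U5, U6}" for k
        using that by (cases k) (simp_all add: weight_\<uu>2)
      then show ?thesis
        using no_weight W False m by metis
    qed
  qed
qed

theorem theorem5p2:
  shows "(\<forall>l. lie_subalgebra_sl3 (\<uu>2 l) \<and> dim (\<uu>2 l) = 2) \<and>
    (\<forall>\<uu>. lie_subalgebra_sl3 \<uu> \<and> dim \<uu> = 2 \<longrightarrow> (\<exists>l. \<uu> \<sim>\<^sub>S\<^sub>L \<uu>2 l)) \<and>
    (\<forall>l m. l \<noteq> m \<longrightarrow> \<not> \<uu>2 l \<sim>\<^sub>S\<^sub>L \<uu>2 m) \<and>
    (\<forall>a b. \<uu>2 (U10 a) \<sim>\<^sub>S\<^sub>L \<uu>2 (U10 b) \<longleftrightarrow> a = b)"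
proof (intro conjI allI impI)
  have refl: "\<uu> \<sim>\<^sub>S\<^sub>L \<uu>" for \<uu>
    unfolding SL3_conjugate_iff
    by (rule exI [of _ "mat 1"]) (simp add: conj_by_def matrix_inv_eqI [of "mat 1" "mat 1"])
  show "lie_subalgebra_sl3 (\<uu>2 l)" "dim (\<uu>2 l) = 2" for l
    by (rule lie_subalgebra_\<uu>2 dim_\<uu>2)+
  show "\<exists>l. \<uu> \<sim>\<^sub>S\<^sub>L \<uu>2 l" if "lie_subalgebra_sl3 \<uu> \<and> dim \<uu> = 2" for \<uu>
    using that classified_two_dim by (simp add: classified_def)
  show "\<not> \<uu>2 l \<sim>\<^sub>S\<^sub>L \<uu>2 m" if "l \<noteq> m" for l m
    using that \<uu>2_not_conjugate by blast
  show "\<uu>2 (U10 a) \<sim>\<^sub>S\<^sub>L \<uu>2 (U10 b) \<longleftrightarrow> a = b" for a b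
    using refl \<uu>2_not_conjugate by blast
qed

end
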